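(* Let $a_0,a_1,b_0,b_1>0$, let $L,M,N$ be positive integers with $M$ and $N$ even, let $A(z)=\begin{pmatrix} b_0 & a_0 \\ {} a_1 z & b_1 \end{pmatrix}$, and let $K$ be the kernel defined in the context. For $x_1,x_2\in\{1,\dots,L-1\}$ and $y_1,y_2\in\mathbb{Z}$, we have $$[K(x_1,2y_1+j,x_2,2y_2+i)]_{i,j=0}^{1}=-\frac{\chi_{x_1>x_2}}{2\pi i}\oint_{\gamma_{\mathbb{C}}}\frac{\big(\frac{b_0+b_1+\zeta}{2}\big)^{x_1-x_2}}{\big(\frac{\zeta^2-(b_0-b_1)^2}{4a_0a_1}\big)^{y_1-y_2+1}}\begin{pmatrix} \frac{\zeta-b_1+b_0}{2} & a_0 \\ {} \frac{\zeta^2-(b_1-b_0)^2}{4a_0} & \frac{\zeta+b_1-b_0}{2} \end{pmatrix}\frac{d\zeta}{2a_0a_1}$$ $$+\frac{1}{2\pi i}\oint_{\gamma_{\mathbb{C}}}\oint_{\gamma_{\mathbb{C}}}\frac{\mathcal{R}_N^{\mathcal{W}}(\omega,\zeta)\big(\frac{b_0+b_1+\zeta}{2}\big)^{x_1}\big(\frac{b_0+b_1+\omega}{2}\big)^{L-x_2}}{\big(\frac{\zeta^2-(b_1-b_0)^2}{4a_1a_0}\big)^{y_1+1}\big(\frac{\omega^2-(b_1-b_0)^2}{4a_1a_0}\big)^{\frac{M+N}{2}-y_2}}\begin{pmatrix} \frac{\zeta-(b_1-b_0)}{2} & a_0 \\ {} \frac{(\zeta-b_1+b_0)(\omega+b_1-b_0)}{4a_0}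 & \frac{\omega+b_1-b_0}{2} \end{pmatrix}\frac{d\zeta\,d\omega}{4a_0^2a_1^2},$$ where $\gamma_{\mathbb{C}}$ is a circle oriented positively and surrounding both $b_0-b_1$ and $b_1-b_0$, and $\mathcal{R}_N^{\mathcal{W}}$ is the scalar Christoffel--Darboux kernel associated to the weight $$\mathcal{W}(\omega)=\frac{1}{2a_0a_1}\Big(\frac{b_0+b_1+\omega}{2}\Big)^{L}\Big(\frac{4a_0a_1}{\omega^2-(b_0-b_1)^2}\Big)^{\frac{M+N}{2}}$$ on $\gamma_{\mathbb{C}}$.
   Context: $\chi_{x_1>x_2}=1$ if $x_1>x_2$ and $0$ otherwise. **CD kernels.** For a contour $\Gamma$, an $m\times m$ matrix weight $V$ on $\Gamma$ and $n\in\mathbb{N}_{>0}$, the Christoffel--Darboux (CD) kernel $\mathcal{R}_n^V(w,z)$ is the unique bivariate $m\times m$ matrix polynomial of degree $\le n-1$ in both $w$ and $z$ such that $\int_\Gamma P(w)V(w)\mathcal{R}_n^V(w,z)dw=P(z)$ for every $m\times m$ matrix polynomial $P$ of degree $\le n-1$ and every $z\in\mathbb{C}$. The scalar CD kernel is the case $m=1$. **The kernel $K$.** $K$ is the correlation kernel of the determinantal process of non-intersecting paths associated with lozenge tilings of a hexagon with a $2\times1$ periodic weighting with edge weights $a_0,a_1,b_0,b_1$, given by the (known) Duits--Kuijlaars formula: with $\gamma$ the positively oriented unit circle and $W(z)=z^{-\frac{M+N}{2}}A(z)^L$ (for which $\mathcal{R}_{N/2}^W$ on $\gamma$ is known to exist),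 $$[K(x_1,2y_1+j,x_2,2y_2+i)]_{i,j=0}^{1}=-\frac{\chi_{x_1>x_2}}{2\pi i}\oint_\gamma A(z)^{x_1-x_2}z^{y_2-y_1-1}dz+\frac{1}{2\pi i}\oint_\gamma\oint_\gamma A(w)^{L-x_2}\mathcal{R}_{N/2}^W(w,z)A(z)^{x_1}\frac{dz\,dw}{w^{\frac{M+N}{2}-y_2}z^{y_1+1}}.$$ *)

theory Defs
  imports "HOL-Complex_Analysis.Complex_Analysis"
begin

section \<open>Complex matrices\<close>

(* The library operations * and ^ on vec are componentwise, hence the following two operations. *)

definition mat_scale :: "complex \<Rightarrow> complex^'m^'n \<Rightarrow> complex^'m^'n"  (infixr "\<cdot>\<^sub>C" 75) where
  "c \<cdot>\<^sub>C A = (\<chi> i j. c * A $ i $ j)"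

primrec mat_power :: "complex^'n^'n \<Rightarrow> nat \<Rightarrow> complex^'n^'n" where
  "mat_power A 0 = mat 1"
| "mat_power A (Suc n) = A ** mat_power A n"

(* Blocks are indexed mathematically by i, j = 0, 1; these are the indices 1, 2 of the type 2
   (where 2 = 0, so that the numerals must not be identified with i and j). *)
definition mat2 :: "complex \<Rightarrow> complex \<Rightarrow> complex \<Rightarrow> complex \<Rightarrow> complex^2^2" where
  "mat2 a b c d = vector [vector [a, b], vector [c, d]]"

definition mat_contour_integral ::
  "(real \<Rightarrow> complex) \<Rightarrow> (complex \<Rightarrow> complex^'m^'n) \<Rightarrow> complex^'m^'n" where
  "mat_contour_integral g F = (\<chi> i j. contour_integral g (\<lambda>z. F z $ i $ j))"

definition has_mat_contour_integral ::
  "(complex \<Rightarrow> complex^'m^'n) \<Rightarrow> complex^'m^'n \<Rightarrow> (real \<Rightarrow> complex) \<Rightarrow> bool" where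
  "has_mat_contour_integral F I g \<longleftrightarrow>
     (\<forall>i j. ((\<lambda>z. F z $ i $ j) has_contour_integral (I $ i $ j)) g)"


section \<open>Christoffel--Darboux kernels\<close>

(* Polynomials are represented by their evaluation functions; "degree \<le> n - 1", n > 0, is
   expressed by n coefficients with indices below n. *)

definition matrix_poly :: "nat \<Rightarrow> (complex \<Rightarrow> complex^'m^'m) \<Rightarrow> bool" where
  "matrix_poly n P \<longleftrightarrow> (\<exists>C. \<forall>z. P z = (\<Sum>k<n. z ^ k \<cdot>\<^sub>C C k))"

definition bivariate_matrix_poly :: "nat \<Rightarrow> (complex \<Rightarrow> complex \<Rightarrow> complex^'m^'m) \<Rightarrow> bool" where
  "bivariate_matrix_poly n R \<longleftrightarrow>
     (\<exists>C. \<forall>w z. R w z = (\<Sum>k<n. \<Sum>l<n. (w ^ k * z ^ l) \<cdot>\<^sub>C C k l))"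

definition is_CD_kernel ::
  "(real \<Rightarrow> complex) \<Rightarrow> (complex \<Rightarrow> complex^'m^'m) \<Rightarrow> nat \<Rightarrow> (complex \<Rightarrow> complex \<Rightarrow> complex^'m^'m) \<Rightarrow> bool"
  where
  "is_CD_kernel g V n R \<longleftrightarrow>
     bivariate_matrix_poly n R \<and>
     (\<forall>P z. matrix_poly n P \<longrightarrow> has_mat_contour_integral (\<lambda>w. P w ** V w ** R w z) (P z) g)"

definition CD_kernel ::
  "(real \<Rightarrow> complex) \<Rightarrow> (complex \<Rightarrow> complex^'m^'m) \<Rightarrow> nat \<Rightarrow> complex \<Rightarrow> complex \<Rightarrow> complex^'m^'m"
  where
  "CD_kernel g V n = (THE R. is_CD_kernel g V n R)"

(* A scalar weight as a 1 x 1 matrix weight. *)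
definition scalar_weight :: "(complex \<Rightarrow> complex) \<Rightarrow> complex \<Rightarrow> complex^1^1" where
  "scalar_weight v = (\<lambda>w. mat (v w))"

definition scalar_CD_kernel ::
  "(real \<Rightarrow> complex) \<Rightarrow> (complex \<Rightarrow> complex) \<Rightarrow> nat \<Rightarrow> complex \<Rightarrow> complex \<Rightarrow> complex" where
  "scalar_CD_kernel g v n w z = CD_kernel g (scalar_weight v) n w z $ 1 $ 1"


section \<open>The hexagon with a 2 x 1 periodic weighting\<close>

abbreviation unit_circle :: "real \<Rightarrow> complex" where
  "unit_circle \<equiv> circlepath 0 1"

definition symbol_A :: "real \<Rightarrow> real \<Rightarrow> real \<Rightarrow> real \<Rightarrow> complex \<Rightarrow> complex^2^2" where
  "symbol_A a0 a1 b0 b1 z = mat2 (of_real b0) (of_real a0) (of_real a1 * z) (of_real b1)"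

definition weight_W ::
  "real \<Rightarrow> real \<Rightarrow> real \<Rightarrow> real \<Rightarrow> nat \<Rightarrow> nat \<Rightarrow> nat \<Rightarrow> complex \<Rightarrow> complex^2^2" where
  "weight_W a0 a1 b0 b1 L M N z =
     z powi (- int ((M + N) div 2)) \<cdot>\<^sub>C mat_power (symbol_A a0 a1 b0 b1 z) L"

(* The natural number subtraction x1 - x2 is only relevant when x1 > x2, and L - x2 is
   meant for x2 \<le> L. *)
definition Duits_Kuijlaars_block ::
  "real \<Rightarrow> real \<Rightarrow> real \<Rightarrow> real \<Rightarrow> nat \<Rightarrow> nat \<Rightarrow> nat \<Rightarrow> nat \<Rightarrow> int \<Rightarrow> nat \<Rightarrow> int \<Rightarrow> complex^2^2" where
  "Duits_Kuijlaars_block a0 a1 b0 b1 L M N x1 y1 x2 y2 =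
     (let A = symbol_A a0 a1 b0 b1;
          R = CD_kernel unit_circle (weight_W a0 a1 b0 b1 L M N) (N div 2)
      in
        - ((of_bool (x1 > x2) / (2 * of_real pi * \<i>)) \<cdot>\<^sub>C
            mat_contour_integral unit_circle
              (\<lambda>z. z powi (y2 - y1 - 1) \<cdot>\<^sub>C mat_power (A z) (x1 - x2)))
        + (1 / (2 * of_real pi * \<i>)) \<cdot>\<^sub>C
            mat_contour_integral unit_circle (\<lambda>w.
              mat_contour_integral unit_circle (\<lambda>z.
                (1 / (w powi (int ((M + N) div 2) - y2) * z powi (y1 + 1))) \<cdot>\<^sub>C
                  (mat_power (A w) (L - x2) ** R w z ** mat_power (A z) x1))))"

(* K is the correlation kernel itself, with entries read off from the 2 x 2 blocks.
   The value K(x1, 2 y1 + j, x2, 2 y2 + i), i, j in {0,1}, is the entry in row i and column j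
   of the block: the row is the parity of the last argument of K, the column that of the second. *)
definition kernel_K ::
  "real \<Rightarrow> real \<Rightarrow> real \<Rightarrow> real \<Rightarrow> nat \<Rightarrow> nat \<Rightarrow> nat \<Rightarrow> nat \<Rightarrow> int \<Rightarrow> nat \<Rightarrow> int \<Rightarrow> complex" where
  "kernel_K a0 a1 b0 b1 L M N x1 u1 x2 u2 =
     Duits_Kuijlaars_block a0 a1 b0 b1 L M N x1 (u1 div 2) x2 (u2 div 2)
       $ (if even u2 then 1 else 2) $ (if even u1 then 1 else 2)"

definition weight_curly_W ::
  "real \<Rightarrow> real \<Rightarrow> real \<Rightarrow> real \<Rightarrow> nat \<Rightarrow> nat \<Rightarrow> nat \<Rightarrow> complex \<Rightarrow> complex" where
  "weight_curly_W a0 a1 b0 b1 L M N \<omega> =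
     1 / (2 * of_real a0 * of_real a1) * ((of_real b0 + of_real b1 + \<omega>) / 2) ^ L
       * (4 * of_real a0 * of_real a1 / (\<omega>\<^sup>2 - (of_real b0 - of_real b1)\<^sup>2)) ^ ((M + N) div 2)"

end

theory Submission
  imports Defs
begin

text \<open>Write \<open>\<delta> = b0 - b1\<close>. The eigenvalues of \<open>A(z)\<close> are \<open>(b0 + b1 + \<zeta>) / 2\<close> and
\<open>(b0 + b1 - \<zeta>) / 2\<close>, where \<open>\<zeta>\<^sup>2 = \<delta>\<^sup>2 + 4 a0 a1 z\<close>. Hence the spectral curve of \<open>A\<close> is rational: it is
the \<open>\<zeta>\<close>-plane, mapped two-to-one onto the \<open>z\<close>-plane by \<open>\<phi>(\<zeta>) = (\<zeta>\<^sup>2 - \<delta>\<^sup>2) / (4 a0 a1)\<close>, and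
\<open>A(\<phi>(\<zeta>))\<close> has the right eigenvector \<open>u(\<zeta>)\<close> (\<open>eigvec\<close>) and the left eigenvector \<open>v(\<zeta>)\<close>
(\<open>coeigvec\<close>) for the first of them, both affine in \<open>\<zeta>\<close>. The theorem transports the matrix problem over the \<open>z\<close>-plane
to a scalar problem over the \<open>\<zeta>\<close>-plane.

The engine is the identity (\<open>pullback\<close>)
\<open>\<integral> z\<^sup>k X(z) A(z)\<^sup>m Y(z) dz = \<integral> \<phi>(\<zeta>)\<^sup>k ((b0 + b1 + \<zeta>) / 2)\<^sup>m X(\<phi>(\<zeta>)) Q(\<zeta>) Y(\<phi>(\<zeta>)) d\<zeta> / (2 a0 a1)\<close>
for matrix polynomials \<open>X\<close>, \<open>Y\<close>, with the unit circle on the left, the given circle on the right, and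
\<open>Q(\<zeta>) = u(\<zeta>) v(\<zeta>)\<^sup>T\<close>. It needs no deformation of contours: the relation \<open>A Q = eigenvalue \<cdot> Q\<close>
splits the integrand on the right into a part that is even in \<open>\<zeta>\<close> and a part that is odd, both
Laurent polynomials in \<open>\<phi>(\<zeta>)\<close> up to a factor \<open>\<zeta>\<close>, and it suffices to know the integrals of
\<open>\<phi>\<^sup>k\<close>, which vanish, and of \<open>\<zeta> \<phi>\<^sup>k\<close>, which is a multiple of \<open>\<phi>\<^sup>k \<phi>'\<close>.

Given a matrix kernel \<open>R\<close>, put \<open>r(\<omega>,\<zeta>) = v(\<omega>)\<^sup>T R(\<phi>(\<omega>),\<phi>(\<zeta>)) u(\<zeta>)\<close>. Every scalar polynomial of degree
below \<open>N\<close> has the form \<open>P(\<phi>(\<zeta>)) u(\<zeta>)\<close> with a row \<open>P\<close> of polynomials of degree below \<open>N/2\<close>, and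
\<open>pullback\<close> turns the reproducing property of \<open>R\<close> for \<open>P\<close> into that of \<open>r\<close>
(\<open>reproducing_scalar_kernel\<close>). A scalar weight is symmetric, which forces uniqueness
of the scalar kernel (\<open>reproducing_kernel_unique\<close>). The matrix kernel is then unique as well,
since \<open>r\<close> determines \<open>R\<close> (\<open>scalar_kernel_inject\<close>); so the kernel in the definition of
\<open>K\<close> is \<open>R\<close> and the scalar Christoffel--Darboux kernel is \<open>r\<close>. Finally, \<open>pullback\<close> applied in each
variable of the double integral produces \<open>Q(\<omega>) R(\<phi>(\<omega>),\<phi>(\<zeta>)) Q(\<zeta>) = r(\<omega>,\<zeta>) u(\<omega>) v(\<zeta>)\<^sup>T\<close>, and
\<open>u(\<omega>) v(\<zeta>)\<^sup>T\<close> is the matrix in the statement.\<close>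

section \<open>Matrices and their contour integrals\<close>

lemma mat_scale_nth [simp]: "(c \<cdot>\<^sub>C A) $ i $ j = c * A $ i $ j"
  by (simp add: mat_scale_def)

lemma mat2_nth [simp]:
  "mat2 a b c d $ 1 $ 1 = a" "mat2 a b c d $ 1 $ 2 = b"
  "mat2 a b c d $ 2 $ 1 = c" "mat2 a b c d $ 2 $ 2 = d"
  by (simp_all add: mat2_def vector_2)

lemma matrix_mult_nth: "(A ** B) $ i $ j = (\<Sum>k\<in>UNIV. A $ i $ k * B $ k $ j)"
  by (simp add: matrix_matrix_mult_def)

lemma mat_scale_mult_left: "(c \<cdot>\<^sub>C A) ** B = c \<cdot>\<^sub>C (A ** B)"
  by (simp add: vec_eq_iff matrix_mult_nth sum_distrib_left mult_ac)

lemma mat_scale_mult_right: "A ** (c \<cdot>\<^sub>C B) = c \<cdot>\<^sub>C (A ** B)"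
  by (simp add: vec_eq_iff matrix_mult_nth sum_distrib_left mult_ac)

lemma matrix_add_mult_distrib: "(A + B) ** C = A ** C + B ** (C :: complex^'k^'m)"
  for A B :: "complex^'m^'n"
  by (simp add: vec_eq_iff matrix_mult_nth sum.distrib distrib_right)

lemma mat_scale_scale: "a \<cdot>\<^sub>C b \<cdot>\<^sub>C A = (a * b) \<cdot>\<^sub>C A"
  by (simp add: vec_eq_iff mult_ac)

lemma sum_matrix_nth: "(\<Sum>k\<in>K. F k) $ i $ j = (\<Sum>k\<in>K. F k $ i $ j)"
  for F :: "'a \<Rightarrow> complex^'m^'n"
  by simp

lemma mat_contour_integral_unique:
  "has_mat_contour_integral F I g \<Longrightarrow> mat_contour_integral g F = I"
  by (simp add: has_mat_contour_integral_def mat_contour_integral_def vec_eq_iff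
      contour_integral_unique)

lemma has_mat_contour_integral_unique:
  "has_mat_contour_integral F I g \<Longrightarrow> has_mat_contour_integral F J g \<Longrightarrow> I = J"
  using mat_contour_integral_unique[of F I g] mat_contour_integral_unique[of F J g] by simp

lemma has_mat_contour_integral_mult_left:
  "has_mat_contour_integral F I g \<Longrightarrow> has_mat_contour_integral (\<lambda>z. B ** F z) (B ** I) g"
  unfolding has_mat_contour_integral_def matrix_mult_nth
  by (intro allI has_contour_integral_sum has_contour_integral_lmul) auto

lemma has_mat_contour_integral_scale:
  "has_mat_contour_integral F I g \<Longrightarrow> has_mat_contour_integral (\<lambda>z. a \<cdot>\<^sub>C F z) (a \<cdot>\<^sub>C I) g"
  by (simp add: has_mat_contour_integral_def has_contour_integral_lmul)

lemma has_mat_contour_integral_sum: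
  "\<lbrakk>finite K; \<And>k. k \<in> K \<Longrightarrow> has_mat_contour_integral (F k) (I k) g\<rbrakk>
    \<Longrightarrow> has_mat_contour_integral (\<lambda>z. \<Sum>k\<in>K. F k z) (\<Sum>k\<in>K. I k) g"
  unfolding has_mat_contour_integral_def sum_matrix_nth
  by (intro allI has_contour_integral_sum) auto

section \<open>Polynomial functions\<close>

definition polynomial_fun :: "(complex \<Rightarrow> complex) \<Rightarrow> bool" where
  "polynomial_fun f \<longleftrightarrow> (\<exists>p. f = poly p)"

definition polynomial_entries :: "(complex \<Rightarrow> complex^'m^'n) \<Rightarrow> bool" where
  "polynomial_entries F \<longleftrightarrow> (\<forall>i j. polynomial_fun (\<lambda>z. F z $ i $ j))"

lemma polynomial_fun_const: "polynomial_fun (\<lambda>z. a)"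
  unfolding polynomial_fun_def by (intro exI[of _ "[:a:]"]) auto

lemma polynomial_fun_id: "polynomial_fun (\<lambda>z. z)"
  unfolding polynomial_fun_def by (intro exI[of _ "[:0, 1:]"]) auto

lemma polynomial_fun_add:
  "polynomial_fun f \<Longrightarrow> polynomial_fun g \<Longrightarrow> polynomial_fun (\<lambda>z. f z + g z)"
  unfolding polynomial_fun_def by (auto simp flip: poly_add)

lemma polynomial_fun_mult:
  "polynomial_fun f \<Longrightarrow> polynomial_fun g \<Longrightarrow> polynomial_fun (\<lambda>z. f z * g z)"
  unfolding polynomial_fun_def by (auto simp flip: poly_mult)

lemma polynomial_fun_power: "polynomial_fun f \<Longrightarrow> polynomial_fun (\<lambda>z. f z ^ k)"
  unfolding polynomial_fun_def by (auto simp flip: poly_power)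

lemma polynomial_fun_sum:
  "(\<And>k. k \<in> K \<Longrightarrow> polynomial_fun (f k)) \<Longrightarrow> polynomial_fun (\<lambda>z. \<Sum>k\<in>K. f k z)"
  by (induction K rule: infinite_finite_induct) (auto intro: polynomial_fun_const polynomial_fun_add)

lemmas polynomial_fun_intros = polynomial_fun_const polynomial_fun_id polynomial_fun_add
  polynomial_fun_mult polynomial_fun_power polynomial_fun_sum

lemma polynomial_entries_const: "polynomial_entries (\<lambda>z. B)"
  by (simp add: polynomial_entries_def polynomial_fun_const)

lemma polynomial_entries_scale:
  "polynomial_fun f \<Longrightarrow> polynomial_entries (\<lambda>z. f z \<cdot>\<^sub>C B)"
  by (simp add: polynomial_entries_def polynomial_fun_mult polynomial_fun_const)

lemma polynomial_entries_mult:
  "polynomial_entries F \<Longrightarrow> polynomial_entries G \<Longrightarrow> polynomial_entries (\<lambda>z. F z ** G z)"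
  unfolding polynomial_entries_def matrix_mult_nth by (intro allI polynomial_fun_intros) auto

lemma polynomial_entries_mat_power:
  "polynomial_entries F \<Longrightarrow> polynomial_entries (\<lambda>z. mat_power (F z) m)"
proof (induction m)
  case 0
  show ?case by (simp add: polynomial_entries_def polynomial_fun_const)
qed (simp add: polynomial_entries_mult)

lemma matrix_poly_polynomial_entries: "matrix_poly n P \<Longrightarrow> polynomial_entries P"
  unfolding matrix_poly_def polynomial_entries_def
  by (auto intro!: polynomial_fun_intros)

lemma powers_sum_iff_poly:
  assumes "n > 0"
  shows "(\<exists>c. \<forall>z::complex. f z = (\<Sum>k<n. z ^ k * c k)) \<longleftrightarrow> (\<exists>p. degree p < n \<and> (\<forall>z. f z = poly p z))"
proof safe
  fix c :: "nat \<Rightarrow> complex" assume c: "\<forall>z. f z = (\<Sum>k<n. z ^ k * c k)"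
  let ?p = "\<Sum>k<n. monom (c k) k"
  have "degree ?p < n"
    using assms by (intro degree_sum_less) (auto intro: le_less_trans[OF degree_monom_le])
  moreover have "f z = poly ?p z" for z
    by (simp add: c poly_sum poly_monom mult.commute)
  ultimately show "\<exists>p. degree p < n \<and> (\<forall>z. f z = poly p z)" by blast
next
  fix p assume p: "degree p < n" "\<forall>z. f z = poly p z"
  have "poly p z = (\<Sum>k<n. z ^ k * coeff p k)" for z
    unfolding poly_altdef
    by (rule sum.mono_neutral_cong_left) (use p(1) in \<open>auto simp: coeff_eq_0\<close>)
  with p(2) show "\<exists>c. \<forall>z. f z = (\<Sum>k<n. z ^ k * c k)" by auto
qed

lemma matrix_poly_iff_entries:
  assumes "n > 0"
  shows "matrix_poly n P \<longleftrightarrow> (\<forall>i j. \<exists>p. degree p < n \<and> (\<forall>z. P z $ i $ j = poly p z))"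
proof -
  have "matrix_poly n P \<longleftrightarrow> (\<forall>i j. \<exists>c. \<forall>z. P z $ i $ j = (\<Sum>k<n. z ^ k * c k))"
  proof
    assume "\<forall>i j. \<exists>c. \<forall>z. P z $ i $ j = (\<Sum>k<n. z ^ k * c k)"
    then obtain c where "\<And>i j z. P z $ i $ j = (\<Sum>k<n. z ^ k * c i j k)" by metis
    then show "matrix_poly n P"
      unfolding matrix_poly_def
      by (intro exI[of _ "\<lambda>k. \<chi> i j. c i j k"]) (simp add: vec_eq_iff)
  qed (auto simp: matrix_poly_def)
  then show ?thesis by (simp only: powers_sum_iff_poly[OF assms])
qed

definition bivariate_poly :: "nat \<Rightarrow> (complex \<Rightarrow> complex \<Rightarrow> complex) \<Rightarrow> bool" where
  "bivariate_poly n r \<longleftrightarrow> (\<exists>c. \<forall>w z. r w z = (\<Sum>k<n. \<Sum>l<n. w ^ k * z ^ l * c k l))"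

lemma bivariate_matrix_poly_iff_entries:
  "bivariate_matrix_poly n R \<longleftrightarrow> (\<forall>i j. bivariate_poly n (\<lambda>w z. R w z $ i $ j))"
proof
  assume "\<forall>i j. bivariate_poly n (\<lambda>w z. R w z $ i $ j)"
  then obtain c where
    "\<forall>i j w z. R w z $ i $ j = (\<Sum>k<n. \<Sum>l<n. w ^ k * z ^ l * c i j k l)"
    unfolding bivariate_poly_def choice_iff by blast
  then show "bivariate_matrix_poly n R"
    unfolding bivariate_matrix_poly_def
    by (intro exI[of _ "\<lambda>k l. \<chi> i j. c i j k l"]) (simp add: vec_eq_iff)
qed (auto simp: bivariate_matrix_poly_def bivariate_poly_def)

lemma bivariate_poly_sections:
  assumes "n > 0" "bivariate_poly n r"
  shows "\<exists>p. degree p < n \<and> (\<forall>w. r w z = poly p w)"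
    and "\<exists>p. degree p < n \<and> (\<forall>z. r w z = poly p z)"
proof -
  from assms(2) obtain c where c: "\<And>w z. r w z = (\<Sum>k<n. \<Sum>l<n. w ^ k * z ^ l * c k l)"
    unfolding bivariate_poly_def by auto
  have "r w z = (\<Sum>k<n. w ^ k * (\<Sum>l<n. z ^ l * c k l))" for w
    by (simp add: c sum_distrib_left mult.assoc)
  then have "\<exists>c. \<forall>w. r w z = (\<Sum>k<n. w ^ k * c k)"
    by (intro exI[of _ "\<lambda>k. \<Sum>l<n. z ^ l * c k l"] allI)
  then show "\<exists>p. degree p < n \<and> (\<forall>w. r w z = poly p w)"
    unfolding powers_sum_iff_poly[OF assms(1)] .
  have "r w z = (\<Sum>l<n. z ^ l * (\<Sum>k<n. w ^ k * c k l))" for z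
    by (simp only: c sum_distrib_left) (subst sum.swap, simp add: mult_ac)
  then have "\<exists>c. \<forall>z. r w z = (\<Sum>l<n. z ^ l * c l)"
    by (intro exI[of _ "\<lambda>l. \<Sum>k<n. w ^ k * c k l"] allI)
  then show "\<exists>p. degree p < n \<and> (\<forall>z. r w z = poly p z)"
    unfolding powers_sum_iff_poly[OF assms(1)] .
qed

lemma polynomial_entries_section:
  assumes "n > 0" "bivariate_matrix_poly n R"
  shows "polynomial_entries (\<lambda>w. R w z)" "polynomial_entries (R w)"
  using bivariate_poly_sections[OF assms(1)] assms(2)
  unfolding polynomial_entries_def polynomial_fun_def bivariate_matrix_poly_iff_entries fun_eq_iff
  by blast+

lemma bivariate_poly_sum:
  assumes "\<And>x. x \<in> X \<Longrightarrow> bivariate_poly n (r x)"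
  shows "bivariate_poly n (\<lambda>w z. \<Sum>x\<in>X. r x w z)"
proof -
  from assms have "\<forall>x\<in>X. \<exists>c. \<forall>w z. r x w z = (\<Sum>k<n. \<Sum>l<n. w ^ k * z ^ l * c k l)"
    unfolding bivariate_poly_def by blast
  from bchoice[OF this] obtain c where c: "\<forall>x\<in>X. \<forall>w z. r x w z = (\<Sum>k<n. \<Sum>l<n. w ^ k * z ^ l * c x k l)"
    by blast
  have "(\<Sum>x\<in>X. r x w z) = (\<Sum>k<n. \<Sum>l<n. w ^ k * z ^ l * (\<Sum>x\<in>X. c x k l))" for w z
  proof -
    have "(\<Sum>x\<in>X. r x w z) = (\<Sum>x\<in>X. \<Sum>k<n. \<Sum>l<n. w ^ k * z ^ l * c x k l)"
      by (intro sum.cong) (auto simp: c)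
    also have "\<dots> = (\<Sum>k<n. \<Sum>x\<in>X. \<Sum>l<n. w ^ k * z ^ l * c x k l)"
      by (rule sum.swap)
    also have "\<dots> = (\<Sum>k<n. \<Sum>l<n. \<Sum>x\<in>X. w ^ k * z ^ l * c x k l)"
      by (intro sum.cong refl sum.swap)
    finally show ?thesis by (simp add: sum_distrib_left)
  qed
  then show ?thesis
    unfolding bivariate_poly_def by (intro exI[of _ "\<lambda>k l. \<Sum>x\<in>X. c x k l"] allI)
qed

lemma bivariate_poly_prod:
  assumes "degree p < n" "degree q < n"
  shows "bivariate_poly n (\<lambda>w z. poly p w * a * poly q z)"
proof -
  have n: "n > 0" using assms by simp
  obtain c where c: "\<And>w. poly p w = (\<Sum>k<n. w ^ k * c k)"
    using powers_sum_iff_poly[OF n, of "poly p"] assms by auto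
  obtain d where d: "\<And>w. poly q w = (\<Sum>k<n. w ^ k * d k)"
    using powers_sum_iff_poly[OF n, of "poly q"] assms by auto
  have "poly p w * a * poly q z = (\<Sum>k<n. \<Sum>l<n. w ^ k * z ^ l * (a * c k * d l))" for w z
    by (simp add: c d sum_product sum_distrib_right sum_distrib_left mult_ac)
  then show ?thesis unfolding bivariate_poly_def
    by (intro exI[of _ "\<lambda>k l. a * c k * d l"]) simp
qed

lemma sum_even_odd: "(\<Sum>i<2 * n. f i) = (\<Sum>k<n. f (2 * k) + f (2 * k + 1))"
  for f :: "nat \<Rightarrow> complex"
  by (induction n) (simp_all add: add.assoc)

lemma poly_eq_except_one_point:
  fixes p q :: "complex poly"
  assumes "\<And>z. z \<noteq> a \<Longrightarrow> poly p z = poly q z"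
  shows "poly p z = poly q z"
proof -
  have "p - q = 0"
  proof (rule ccontr)
    assume "p - q \<noteq> 0"
    then have "finite {z. poly (p - q) z = 0}" by (rule poly_roots_finite)
    moreover have "UNIV - {a} \<subseteq> {z. poly (p - q) z = 0}" using assms by auto
    ultimately have "finite (UNIV - {a})" by (rule rev_finite_subset)
    then show False by (simp add: infinite_UNIV_char_0)
  qed
  then show ?thesis by simp
qed

text \<open>Both variables may avoid the exceptional point: it is filled in first in one variable and then in
the other, each time because a polynomial is determined by its values off one point.\<close>

lemma bivariate_poly_eq_except_point:
  assumes n: "n > 0" and r: "bivariate_poly n r1" "bivariate_poly n r2"
    and eq: "\<And>w z. w \<noteq> a \<Longrightarrow> z \<noteq> a \<Longrightarrow> r1 w z = r2 w z"
  shows "r1 w z = r2 w z"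
proof -
  have first: "r1 w z = r2 w z" if "z \<noteq> a" for w z
  proof -
    obtain p q where "\<And>w. r1 w z = poly p w" "\<And>w. r2 w z = poly q w"
      using bivariate_poly_sections(1)[OF n r(1), of z] bivariate_poly_sections(1)[OF n r(2), of z] by auto
    with poly_eq_except_one_point[of a p q w] eq[OF _ that] show ?thesis by simp
  qed
  obtain p q where "\<And>z. r1 w z = poly p z" "\<And>z. r2 w z = poly q z"
    using bivariate_poly_sections(2)[OF n r(1), of w] bivariate_poly_sections(2)[OF n r(2), of w] by auto
  with poly_eq_except_one_point[of a p q z] first[of _ w] show ?thesis by simp
qed

section \<open>Contour integrals of Laurent polynomials\<close>

definition circle_moment :: "int \<Rightarrow> complex" where
  "circle_moment k = (if k = -1 then 2 * of_real pi * \<i> else 0)"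

lemma has_contour_integral_powi_deriv:
  assumes "\<And>z. z \<in> path_image g \<Longrightarrow> (f has_field_derivative f' z) (at z)"
    and "\<And>z. z \<in> path_image g \<Longrightarrow> f z \<noteq> 0"
    and "valid_path g" "pathfinish g = pathstart g" "k \<noteq> -1"
  shows "((\<lambda>z. f z powi k * f' z) has_contour_integral 0) g"
proof -
  have "((\<lambda>z. f z powi k * f' z) has_contour_integral
      f (pathfinish g) powi (k + 1) / of_int (k + 1) - f (pathstart g) powi (k + 1) / of_int (k + 1)) g"
  proof (rule contour_integral_primitive[where S = "path_image g"])
    fix z assume z: "z \<in> path_image g"
    have nz: "of_int k + 1 \<noteq> (0::complex)"
      using \<open>k \<noteq> -1\<close> by (metis add_eq_0_iff2 of_int_1 of_int_eq_iff of_int_minus)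
    have "(f has_field_derivative f' z) (at z within path_image g)"
      by (rule has_field_derivative_at_within[OF assms(1)[OF z]])
    from DERIV_cdivide[OF DERIV_power_int[OF this disjI2[OF assms(2)[OF z]], of "k + 1"], of "of_int (k + 1)"] nz
    show "((\<lambda>z. f z powi (k + 1) / of_int (k + 1)) has_field_derivative f z powi k * f' z)
        (at z within path_image g)"
      by simp
  qed (use assms in auto)
  then show ?thesis using assms(4) by simp
qed

lemma has_contour_integral_unit_circle_powi:
  "((\<lambda>z. z powi k) has_contour_integral circle_moment k) unit_circle"
proof (cases "k = -1")
  case True
  have "((\<lambda>u. 1 / (u - 0)) has_contour_integral 2 * of_real pi * \<i> * 1) unit_circle"
    by (rule Cauchy_integral_circlepath_simple) (auto intro!: holomorphic_intros)
  then show ?thesis using True by (simp add: circle_moment_def power_int_minus inverse_eq_divide)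
next
  case False
  have "((\<lambda>z. z powi k * 1) has_contour_integral 0) unit_circle"
    by (rule has_contour_integral_powi_deriv[where f = "\<lambda>z. z"]) (use False in auto)
  with False show ?thesis by (simp add: circle_moment_def)
qed

text \<open>By linearity, the integrals of all \<open>f\<^sup>k h\<close> determine those of \<open>f\<^sup>k p(f) h\<close> for every polynomial \<open>p\<close>.
This is used three times: with \<open>f = z\<close>, \<open>h = 1\<close> on the unit circle, and with \<open>f = \<phi>\<close> and \<open>h = 1\<close> or
\<open>h = \<zeta>\<close> on the circle in the \<open>\<zeta>\<close>-plane. The integrals of \<open>z\<^sup>k p(z)\<close>
and of \<open>\<phi>\<^sup>k p(\<phi>) \<zeta>\<close> then differ only in the moments \<open>\<mu>\<close>.\<close>

lemma has_contour_integral_laurent_poly: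
  assumes moments: "\<And>k. ((\<lambda>z. f z powi k * h z) has_contour_integral \<mu> k) g"
    and nz: "\<And>z. z \<in> path_image g \<Longrightarrow> f z \<noteq> 0"
  shows "((\<lambda>z. f z powi k * poly p (f z) * h z) has_contour_integral
            (\<Sum>i\<le>degree p. coeff p i * \<mu> (k + int i))) g"
proof -
  have "((\<lambda>z. \<Sum>i\<le>degree p. coeff p i * (f z powi (k + int i) * h z)) has_contour_integral
            (\<Sum>i\<le>degree p. coeff p i * \<mu> (k + int i))) g"
    by (intro has_contour_integral_sum has_contour_integral_lmul moments) auto
  then show ?thesis
  proof (rule has_contour_integral_eq)
    fix z assume "z \<in> path_image g"
    from nz[OF this] show "(\<Sum>i\<le>degree p. coeff p i * (f z powi (k + int i) * h z))
        = f z powi k * poly p (f z) * h z"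
      by (simp add: poly_altdef sum_distrib_left sum_distrib_right power_int_add mult_ac)
  qed
qed

text \<open>A recurrence between integrals can thus be solved for a term whose existence as an integral is not yet
known.\<close>

lemma has_contour_integral_scaleD:
  assumes "((\<lambda>z. a * f z + b * h z) has_contour_integral 0) g" "(h has_contour_integral 0) g"
    and "a \<noteq> (0::complex)"
  shows "(f has_contour_integral 0) g"
proof -
  have "((\<lambda>z. inverse a * ((a * f z + b * h z) - b * h z)) has_contour_integral inverse a * (0 - b * 0)) g"
    by (intro has_contour_integral_lmul has_contour_integral_diff assms)
  with \<open>a \<noteq> 0\<close> show ?thesis by (simp flip: mult.assoc)
qed

section \<open>Scalar Christoffel--Darboux kernels\<close>

definition reproducing_kernel ::
  "(real \<Rightarrow> complex) \<Rightarrow> (complex \<Rightarrow> complex) \<Rightarrow> nat \<Rightarrow> (complex \<Rightarrow> complex \<Rightarrow> complex) \<Rightarrow> bool" where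
  "reproducing_kernel g v n r \<longleftrightarrow> bivariate_poly n r \<and>
     (\<forall>p z. degree p < n \<longrightarrow> ((\<lambda>w. poly p w * v w * r w z) has_contour_integral poly p z) g)"

lemma is_CD_kernel_scalar_iff:
  assumes n: "n > 0"
  shows "is_CD_kernel g (scalar_weight v) n R \<longleftrightarrow> reproducing_kernel g v n (\<lambda>w z. R w z $ 1 $ 1)"
proof -
  have entry: "has_mat_contour_integral (\<lambda>w. P w ** scalar_weight v w ** R w z) (P z) g \<longleftrightarrow>
      ((\<lambda>w. P w $ 1 $ 1 * v w * R w z $ 1 $ 1) has_contour_integral P z $ 1 $ 1) g"
    for P :: "complex \<Rightarrow> complex^1^1" and z
    by (simp add: has_mat_contour_integral_def forall_1 matrix_mult_nth sum_1 scalar_weight_def mat_def)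
  have "(\<forall>(P :: complex \<Rightarrow> complex^1^1) z. matrix_poly n P \<longrightarrow>
        ((\<lambda>w. P w $ 1 $ 1 * v w * R w z $ 1 $ 1) has_contour_integral P z $ 1 $ 1) g) \<longleftrightarrow>
      (\<forall>p z. degree p < n \<longrightarrow>
        ((\<lambda>w. poly p w * v w * R w z $ 1 $ 1) has_contour_integral poly p z) g)" (is "?L = ?R")
  proof
    assume L: ?L
    show ?R
    proof (intro allI impI)
      fix p :: "complex poly" and z assume "degree p < n"
      then have mp: "matrix_poly n (\<lambda>z. mat (poly p z) :: complex^1^1)"
        by (auto simp: matrix_poly_iff_entries[OF n] forall_1 mat_def)
      from L[rule_format, OF mp, of z]
      show "((\<lambda>w. poly p w * v w * R w z $ 1 $ 1) has_contour_integral poly p z) g"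
        by (simp add: mat_def)
    qed
  next
    assume ?R
    then show ?L
      unfolding matrix_poly_iff_entries[OF n] forall_1 by auto
  qed
  then show ?thesis
    by (simp add: is_CD_kernel_def reproducing_kernel_def bivariate_matrix_poly_iff_entries
        forall_1 entry)
qed

text \<open>Evaluate \<open>\<integral> r1(w,y) v(w) r2(w,z) dw\<close> twice, with \<open>r2\<close> reproducing \<open>r1(\<cdot>,y)\<close> and with \<open>r1\<close> reproducing
\<open>r2(\<cdot>,z)\<close>. This works because scalars commute, and replaces the inversion of the
moment matrix of \<open>v\<close>.\<close>

lemma reproducing_kernels_transpose:
  assumes n: "n > 0" and r1: "reproducing_kernel g v n r1" and r2: "reproducing_kernel g v n r2"
  shows "r1 z y = r2 y z"
proof -
  obtain p where p: "degree p < n" "\<And>w. r1 w y = poly p w"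
    using bivariate_poly_sections(1)[OF n, of r1 y] r1 unfolding reproducing_kernel_def by auto
  obtain q where q: "degree q < n" "\<And>w. r2 w z = poly q w"
    using bivariate_poly_sections(1)[OF n, of r2 z] r2 unfolding reproducing_kernel_def by auto
  have "((\<lambda>w. poly p w * v w * r2 w z) has_contour_integral poly p z) g"
    using r2 p(1) unfolding reproducing_kernel_def by blast
  moreover have "((\<lambda>w. poly q w * v w * r1 w y) has_contour_integral poly q y) g"
    using r1 q(1) unfolding reproducing_kernel_def by blast
  ultimately have "poly p z = poly q y"
    by (simp add: p(2) q(2) mult_ac has_contour_integral_unique)
  then show ?thesis by (simp add: p(2) q(2))
qed

text \<open>Applied to \<open>r1\<close> and itself, the preceding lemma says that \<open>r1\<close> is symmetric; applied to \<open>r1\<close> and \<open>r2\<close>, it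
says that \<open>r1\<close> is the transpose of \<open>r2\<close>.\<close>

lemma reproducing_kernel_unique:
  assumes "n > 0" "reproducing_kernel g v n r1" "reproducing_kernel g v n r2"
  shows "r1 = r2"
proof (intro ext)
  fix w z
  have "r1 w z = r1 z w"
    by (rule reproducing_kernels_transpose[OF assms(1,2,2)])
  also have "r1 z w = r2 w z"
    by (rule reproducing_kernels_transpose[OF assms])
  finally show "r1 w z = r2 w z" .
qed

lemma scalar_CD_kernel_unique:
  assumes n: "n > 0" and r: "reproducing_kernel g v n r"
  shows "\<exists>!R. is_CD_kernel g (scalar_weight v) n R" and "scalar_CD_kernel g v n = r"
proof -
  let ?R = "\<lambda>w z. mat (r w z) :: complex^1^1"
  have R: "is_CD_kernel g (scalar_weight v) n ?R"
    using r by (simp add: is_CD_kernel_scalar_iff[OF n] mat_def)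
  have uniq: "R = ?R" if "is_CD_kernel g (scalar_weight v) n R" for R
  proof -
    from that have "(\<lambda>w z. R w z $ 1 $ 1) = r"
      unfolding is_CD_kernel_scalar_iff[OF n] by (rule reproducing_kernel_unique[OF n _ r])
    then show ?thesis by (auto simp: fun_eq_iff vec_eq_iff forall_1 mat_def)
  qed
  from R uniq show "\<exists>!R. is_CD_kernel g (scalar_weight v) n R" by blast
  have "CD_kernel g (scalar_weight v) n = ?R"
    unfolding CD_kernel_def by (rule the_equality[where a = ?R]) (rule R, rule uniq)
  then show "scalar_CD_kernel g v n = r"
    by (simp add: scalar_CD_kernel_def mat_def fun_eq_iff)
qed

section \<open>The spectral curve of the symbol\<close>

text \<open>The circle encloses the two zeros \<open>\<delta>\<close> and \<open>- \<delta>\<close> of \<open>\<phi>\<close>, that is, the two points of the spectral curve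
over \<open>z = 0\<close>; this is how it can replace the unit circle.\<close>

locale spectral_curve =
  fixes a0 a1 b0 b1 :: real and c :: complex and r :: real
  assumes a0: "a0 > 0" and a1: "a1 > 0" and r: "r > 0"
    and zeros_enclosed: "of_real (b0 - b1) \<in> ball c r" "of_real (b1 - b0) \<in> ball c r"
begin

abbreviation A :: "complex \<Rightarrow> complex^2^2" where
  "A \<equiv> symbol_A a0 a1 b0 b1"

abbreviation \<Gamma> :: "real \<Rightarrow> complex" where
  "\<Gamma> \<equiv> circlepath c r"

abbreviation \<delta> :: complex where
  "\<delta> \<equiv> of_real b0 - of_real b1"

definition \<phi> :: "complex \<Rightarrow> complex" where
  "\<phi> \<zeta> = (\<zeta>\<^sup>2 - \<delta>\<^sup>2) / (4 * of_real a0 * of_real a1)"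

definition eigval :: "complex \<Rightarrow> complex" where
  "eigval \<zeta> = (of_real b0 + of_real b1 + \<zeta>) / 2"

definition eigvec :: "complex \<Rightarrow> complex^2" where
  "eigvec \<zeta> = vector [1, (\<zeta> - \<delta>) / (2 * of_real a0)]"

definition coeigvec :: "complex \<Rightarrow> complex^2" where
  "coeigvec \<zeta> = vector [(\<zeta> + \<delta>) / 2, of_real a0]"

text \<open>Off \<open>\<zeta> = 0\<close>, \<open>Q(\<zeta>) / \<zeta>\<close> is the spectral projection of \<open>A(\<phi>(\<zeta>))\<close> for \<open>eigval \<zeta>\<close>. Without the division, \<open>Q\<close> is
polynomial in \<open>\<zeta>\<close>; the missing \<open>\<zeta>\<close> is absorbed by \<open>dz = \<zeta> d\<zeta> / (2 a0 a1)\<close>.\<close>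

definition Q :: "complex \<Rightarrow> complex^2^2" where
  "Q \<zeta> = (\<chi> i j. eigvec \<zeta> $ i * coeigvec \<zeta> $ j)"

lemma a0a1_nz [simp]: "a0 \<noteq> 0" "a1 \<noteq> 0"
  using a0 a1 by auto

lemma eigvec_nth [simp]: "eigvec \<zeta> $ 1 = 1" "eigvec \<zeta> $ 2 = (\<zeta> - \<delta>) / (2 * of_real a0)"
  by (simp_all add: eigvec_def vector_2)

lemma coeigvec_nth [simp]: "coeigvec \<zeta> $ 1 = (\<zeta> + \<delta>) / 2" "coeigvec \<zeta> $ 2 = of_real a0"
  by (simp_all add: coeigvec_def vector_2)

lemma \<phi>_mult: "of_real a1 * \<phi> \<zeta> = (\<zeta>\<^sup>2 - \<delta>\<^sup>2) / (4 * of_real a0)"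
  by (simp add: \<phi>_def field_simps)

text \<open>This is the decomposition of \<open>Q\<close> into its even and odd parts, as \<open>\<phi>\<close> is even.\<close>

lemma Q_eq_symbol:
  "Q \<zeta> = A (\<phi> \<zeta>) + (- (of_real b0 + of_real b1) / 2) \<cdot>\<^sub>C mat 1 + (\<zeta> / 2) \<cdot>\<^sub>C mat 1"
  by (simp add: vec_eq_iff forall_2 Q_def symbol_A_def \<phi>_mult mat_def)
    (simp add: field_simps power2_eq_square)

lemma symbol_mult_Q: "A (\<phi> \<zeta>) ** Q \<zeta> = eigval \<zeta> \<cdot>\<^sub>C Q \<zeta>"
  by (simp add: vec_eq_iff forall_2 matrix_mult_nth sum_2 Q_def symbol_A_def \<phi>_mult eigval_def)
    (simp add: field_simps power2_eq_square)

lemma symbol_power_mult_Q: "mat_power (A (\<phi> \<zeta>)) m ** Q \<zeta> = eigval \<zeta> ^ m \<cdot>\<^sub>C Q \<zeta>"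
proof (induction m)
  case (Suc m)
  have "mat_power (A (\<phi> \<zeta>)) (Suc m) ** Q \<zeta> = A (\<phi> \<zeta>) ** (eigval \<zeta> ^ m \<cdot>\<^sub>C Q \<zeta>)"
    by (simp add: Suc.IH flip: matrix_mul_assoc)
  also have "\<dots> = eigval \<zeta> ^ Suc m \<cdot>\<^sub>C Q \<zeta>"
    by (simp add: mat_scale_mult_right symbol_mult_Q mat_scale_scale mult.commute)
  finally show ?case .
qed (simp add: vec_eq_iff)

lemma \<phi>_has_field_derivative: "(\<phi> has_field_derivative \<zeta> / (2 * of_real a0 * of_real a1)) (at \<zeta>)"
  unfolding \<phi>_def by (auto intro!: derivative_eq_intros simp: field_simps)

lemma \<phi>_nonzero:
  assumes "\<zeta> \<in> path_image \<Gamma>"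
  shows "\<phi> \<zeta> \<noteq> 0"
proof
  assume "\<phi> \<zeta> = 0"
  then have "(\<zeta> - \<delta>) * (\<zeta> + \<delta>) = 0"
    by (simp add: \<phi>_def power2_eq_square algebra_simps)
  then have "\<zeta> - \<delta> = 0 \<or> \<zeta> + \<delta> = 0"
    unfolding mult_eq_0_iff .
  then have "\<zeta> = of_real (b0 - b1) \<or> \<zeta> = of_real (b1 - b0)"
    by (simp add: add_eq_0_iff2)
  with zeros_enclosed have "dist c \<zeta> < r" by auto
  with assms r show False by auto
qed

section \<open>Moments on the spectral curve\<close>

text \<open>The integrand is the derivative of \<open>\<zeta> \<phi>(\<zeta>)\<^sup>k\<close>, by \<open>\<zeta> \<phi>'(\<zeta>) = 2 \<phi>(\<zeta>) + 2 \<delta>\<^sup>2 / (4 a0 a1)\<close>. It relates the integrals of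
\<open>\<phi>\<^sup>k\<close> and \<open>\<phi>\<^sup>k\<^sup>-\<^sup>1\<close>.\<close>

lemma \<phi>_powi_recurrence:
  "((\<lambda>\<zeta>. (1 + 2 * of_int k) * \<phi> \<zeta> powi k
       + 2 * of_int k * (\<delta>\<^sup>2 / (4 * of_real a0 * of_real a1)) * \<phi> \<zeta> powi (k - 1))
     has_contour_integral 0) \<Gamma>"
proof -
  let ?e = "\<delta>\<^sup>2 / (4 * of_real a0 * of_real a1)"
  let ?f = "\<lambda>\<zeta>. (1 + 2 * of_int k) * \<phi> \<zeta> powi k + 2 * of_int k * ?e * \<phi> \<zeta> powi (k - 1)"
  have "(?f has_contour_integral
      pathfinish \<Gamma> * \<phi> (pathfinish \<Gamma>) powi k - pathstart \<Gamma> * \<phi> (pathstart \<Gamma>) powi k) \<Gamma>"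
  proof (rule contour_integral_primitive[where S = "path_image \<Gamma>"])
    fix \<zeta> assume \<zeta>: "\<zeta> \<in> path_image \<Gamma>"
    note nz = \<phi>_nonzero[OF \<zeta>]
    have "((\<lambda>\<zeta>. \<zeta> * \<phi> \<zeta> powi k) has_field_derivative
        1 * \<phi> \<zeta> powi k + of_int k * \<phi> \<zeta> powi (k - 1) * (\<zeta> / (2 * of_real a0 * of_real a1)) * \<zeta>)
        (at \<zeta> within path_image \<Gamma>)"
      by (intro DERIV_mult DERIV_ident DERIV_power_int disjI2[OF nz]
          has_field_derivative_at_within[OF \<phi>_has_field_derivative])
    moreover have "\<phi> \<zeta> powi k = \<phi> \<zeta> powi (k - 1) * \<phi> \<zeta>"
      using nz by (simp add: power_int_diff)
    moreover have sq: "2 * (\<phi> \<zeta> + ?e) = \<zeta>\<^sup>2 / (2 * of_real a0 * of_real a1)"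
      by (simp add: \<phi>_def field_simps)
    have "of_int k * \<phi> \<zeta> powi (k - 1) * (\<zeta> / (2 * of_real a0 * of_real a1)) * \<zeta>
        = of_int k * \<phi> \<zeta> powi (k - 1) * (2 * (\<phi> \<zeta> + ?e))"
      unfolding sq by (simp add: power2_eq_square)
    ultimately show "((\<lambda>\<zeta>. \<zeta> * \<phi> \<zeta> powi k) has_field_derivative ?f \<zeta>) (at \<zeta> within path_image \<Gamma>)"
      by (simp add: algebra_simps)
  qed (use r in auto)
  then show ?thesis by simp
qed

lemma has_contour_integral_\<Gamma>_pole:
  assumes "a \<in> ball c r"
  shows "((\<lambda>\<zeta>. 1 / (\<zeta> - a)) has_contour_integral 2 * of_real pi * \<i>) \<Gamma>"
  using Cauchy_integral_circlepath_simple[OF holomorphic_on_const, of a c r 1] assms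
  by (simp add: dist_norm norm_minus_commute)

lemma \<phi>_inverse_partial_fractions:
  assumes "\<zeta> \<in> path_image \<Gamma>"
  shows "inverse (\<phi> \<zeta>) * \<zeta> = 2 * of_real a0 * of_real a1 * (1 / (\<zeta> - \<delta>) + 1 / (\<zeta> + \<delta>))"
    and "\<delta> * inverse (\<phi> \<zeta>) = 2 * of_real a0 * of_real a1 * (1 / (\<zeta> - \<delta>) - 1 / (\<zeta> + \<delta>))"
proof -
  have sq: "\<zeta>\<^sup>2 - \<delta>\<^sup>2 = (\<zeta> - \<delta>) * (\<zeta> + \<delta>)"
    by (simp add: power2_eq_square algebra_simps)
  from \<phi>_nonzero[OF assms] have nz: "\<zeta> - \<delta> \<noteq> 0" "\<zeta> + \<delta> \<noteq> 0"
    unfolding \<phi>_def sq by auto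
  have i: "inverse (\<phi> \<zeta>) = 4 * of_real a0 * of_real a1 / ((\<zeta> - \<delta>) * (\<zeta> + \<delta>))"
    by (simp add: \<phi>_def sq)
  define p q where "p = \<zeta> - \<delta>" and "q = \<zeta> + \<delta>"
  from nz have pq: "p \<noteq> 0" "q \<noteq> 0" unfolding p_def q_def .
  have z: "\<zeta> = (p + q) / 2" and d: "\<delta> = (q - p) / 2" by (simp_all add: p_def q_def)
  have "1 / p + 1 / q = (p + q) / (p * q)" "1 / p - 1 / q = (q - p) / (p * q)"
    using pq by (simp_all add: field_simps)
  then show "inverse (\<phi> \<zeta>) * \<zeta> = 2 * of_real a0 * of_real a1 * (1 / (\<zeta> - \<delta>) + 1 / (\<zeta> + \<delta>))"
    and "\<delta> * inverse (\<phi> \<zeta>) = 2 * of_real a0 * of_real a1 * (1 / (\<zeta> - \<delta>) - 1 / (\<zeta> + \<delta>))"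
    unfolding i p_def[symmetric] q_def[symmetric] by (simp_all add: z d)
qed

text \<open>Morally the integrand is even and the circle may be centred at \<open>0\<close>. The proof uses the recurrence instead:
its first coefficient \<open>1 + 2k\<close> never vanishes, which settles \<open>\<delta> = 0\<close> and, starting from \<open>k = 0\<close>, all
\<open>k \<ge> 0\<close>. Its second coefficient vanishes only for \<open>k = 0\<close> when \<open>\<delta> \<noteq> 0\<close>, so that the negative exponents
descend from \<open>k = -1\<close>, where the two simple poles at \<open>\<delta>\<close> and \<open>- \<delta>\<close> have opposite residues.\<close>

lemma even_moments: "((\<lambda>\<zeta>. \<phi> \<zeta> powi k) has_contour_integral 0) \<Gamma>"
proof (cases "\<delta> = 0")
  case True
  have "1 + 2 * of_int k = (of_int (1 + 2 * k) :: complex)" by simp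
  also have "\<dots> \<noteq> 0" by (subst of_int_eq_0_iff) presburger
  finally show ?thesis
    using \<phi>_powi_recurrence[of k] has_contour_integral_scaleD[of _ _ 0 "\<lambda>_. 0"]
    by (simp add: True has_contour_integral_0)
next
  case False
  let ?e = "\<delta>\<^sup>2 / (4 * of_real a0 * of_real a1)"
  have base0: "((\<lambda>\<zeta>. \<phi> \<zeta> powi 0) has_contour_integral 0) \<Gamma>"
    using \<phi>_powi_recurrence[of 0] by simp
  have up: "((\<lambda>\<zeta>. \<phi> \<zeta> powi k) has_contour_integral 0) \<Gamma>"
    if "((\<lambda>\<zeta>. \<phi> \<zeta> powi (k - 1)) has_contour_integral 0) \<Gamma>" for k
  proof -
    have "1 + 2 * of_int k = (of_int (1 + 2 * k) :: complex)" by simp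
    also have "\<dots> \<noteq> 0" by (subst of_int_eq_0_iff) presburger
    finally show ?thesis using has_contour_integral_scaleD[OF \<phi>_powi_recurrence[of k] that] by simp
  qed
  have down: "((\<lambda>\<zeta>. \<phi> \<zeta> powi (k - 1)) has_contour_integral 0) \<Gamma>"
    if "((\<lambda>\<zeta>. \<phi> \<zeta> powi k) has_contour_integral 0) \<Gamma>" "k \<noteq> 0" for k
  proof -
    have "2 * of_int k * ?e \<noteq> 0" using False \<open>k \<noteq> 0\<close> by simp
    moreover have "((\<lambda>\<zeta>. 2 * of_int k * ?e * \<phi> \<zeta> powi (k - 1) + (1 + 2 * of_int k) * \<phi> \<zeta> powi k)
        has_contour_integral 0) \<Gamma>"
      using \<phi>_powi_recurrence[of k] by (simp only: add.commute)
    ultimately show ?thesis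
      using has_contour_integral_scaleD[where a = "2 * of_int k * ?e"
          and f = "\<lambda>\<zeta>. \<phi> \<zeta> powi (k - 1)" and b = "1 + 2 * of_int k", OF _ that(1)]
      by blast
  qed
  have "((\<lambda>\<zeta>. (2 * of_real a0 * of_real a1 / \<delta>) * (1 / (\<zeta> - \<delta>) - 1 / (\<zeta> - (- \<delta>))))
      has_contour_integral (2 * of_real a0 * of_real a1 / \<delta>) * (2 * of_real pi * \<i> - 2 * of_real pi * \<i>)) \<Gamma>"
    using zeros_enclosed
    by (intro has_contour_integral_lmul has_contour_integral_diff has_contour_integral_\<Gamma>_pole) auto
  then have base1: "((\<lambda>\<zeta>. \<phi> \<zeta> powi (-1)) has_contour_integral 0) \<Gamma>"
  proof (subst (asm) diff_self, subst (asm) mult_zero_right, elim has_contour_integral_eq)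
    fix \<zeta> assume "\<zeta> \<in> path_image \<Gamma>"
    note pf = \<phi>_inverse_partial_fractions(2)[OF this]
    have "\<phi> \<zeta> powi (-1) = \<delta> * inverse (\<phi> \<zeta>) / \<delta>"
      by (simp only: power_int_minus power_int_1_right nonzero_mult_div_cancel_left[OF False])
    then show "(2 * of_real a0 * of_real a1 / \<delta>) * (1 / (\<zeta> - \<delta>) - 1 / (\<zeta> - (- \<delta>))) = \<phi> \<zeta> powi (-1)"
      unfolding pf by (simp only: times_divide_eq_left diff_minus_eq_add)
  qed
  show ?thesis
  proof (cases "k \<ge> 0")
    case True
    then show ?thesis by (induction k rule: int_ge_induct) (use base0 up[of "_ + 1"] in auto)
  next
    case False
    then have "k \<le> -1" by simp
    then show ?thesis by (induction k rule: int_le_induct) (use base1 down in auto)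
  qed
qed

text \<open>As \<open>\<zeta>\<close> is \<open>2 a0 a1 \<phi>'(\<zeta>)\<close>, only \<open>k = -1\<close> contributes, namely the number of zeros of \<open>\<phi>\<close> inside the circle:
two, whence \<open>4 a0 a1\<close> rather than \<open>2 a0 a1\<close>.\<close>

lemma odd_moments:
  "((\<lambda>\<zeta>. \<phi> \<zeta> powi k * \<zeta>) has_contour_integral 4 * of_real a0 * of_real a1 * circle_moment k) \<Gamma>"
proof (cases "k = -1")
  case True
  have "((\<lambda>\<zeta>. 2 * of_real a0 * of_real a1 * (1 / (\<zeta> - \<delta>) + 1 / (\<zeta> - (- \<delta>))))
      has_contour_integral 2 * of_real a0 * of_real a1 * (2 * of_real pi * \<i> + 2 * of_real pi * \<i>)) \<Gamma>"
    using zeros_enclosed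
    by (intro has_contour_integral_lmul has_contour_integral_add has_contour_integral_\<Gamma>_pole) auto
  then have "((\<lambda>\<zeta>. \<phi> \<zeta> powi k * \<zeta>)
      has_contour_integral 2 * of_real a0 * of_real a1 * (2 * of_real pi * \<i> + 2 * of_real pi * \<i>)) \<Gamma>"
  proof (rule has_contour_integral_eq)
    fix \<zeta> assume "\<zeta> \<in> path_image \<Gamma>"
    from \<phi>_inverse_partial_fractions(1)[OF this]
    show "2 * of_real a0 * of_real a1 * (1 / (\<zeta> - \<delta>) + 1 / (\<zeta> - (- \<delta>))) = \<phi> \<zeta> powi k * \<zeta>"
      by (simp add: True power_int_minus)
  qed
  then show ?thesis by (simp add: True circle_moment_def algebra_simps)
next
  case False
  have "((\<lambda>\<zeta>. (2 * of_real a0 * of_real a1) * (\<phi> \<zeta> powi k * (\<zeta> / (2 * of_real a0 * of_real a1))))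
      has_contour_integral (2 * of_real a0 * of_real a1) * 0) \<Gamma>"
    by (intro has_contour_integral_lmul has_contour_integral_powi_deriv)
      (use False r \<phi>_has_field_derivative \<phi>_nonzero in auto)
  then show ?thesis using False by (simp add: circle_moment_def)
qed

text \<open>The even part \<open>g(\<phi>)\<close> integrates to \<open>0\<close>. The factor \<open>1/2\<close> of the odd part compensates that \<open>\<phi>\<close> covers the
\<open>z\<close>-plane twice.\<close>

lemma pullback_scalar:
  assumes "polynomial_fun f" "polynomial_fun g"
  shows "\<exists>I. ((\<lambda>z. z powi k * f z) has_contour_integral I) unit_circle \<and>
     ((\<lambda>\<zeta>. \<phi> \<zeta> powi k / (2 * of_real a0 * of_real a1) * (g (\<phi> \<zeta>) + \<zeta> / 2 * f (\<phi> \<zeta>)))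
        has_contour_integral I) \<Gamma>"
proof -
  let ?\<kappa> = "4 * of_real a0 * of_real a1 :: complex"
  from assms obtain p q where p: "f = poly p" and q: "g = poly q"
    unfolding polynomial_fun_def by auto
  let ?I = "\<Sum>i\<le>degree p. coeff p i * circle_moment (k + int i)"
  have 1: "((\<lambda>z. z powi k * poly p z * 1) has_contour_integral ?I) unit_circle"
    by (rule has_contour_integral_laurent_poly)
      (use has_contour_integral_unit_circle_powi in auto)
  have odd: "((\<lambda>\<zeta>. \<phi> \<zeta> powi k * poly p (\<phi> \<zeta>) * \<zeta>) has_contour_integral
      (\<Sum>i\<le>degree p. coeff p i * (?\<kappa> * circle_moment (k + int i)))) \<Gamma>"
    by (rule has_contour_integral_laurent_poly) (use odd_moments \<phi>_nonzero in auto)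
  have even: "((\<lambda>\<zeta>. \<phi> \<zeta> powi k * poly q (\<phi> \<zeta>) * 1) has_contour_integral
      (\<Sum>i\<le>degree q. coeff q i * 0)) \<Gamma>"
    by (rule has_contour_integral_laurent_poly) (use even_moments \<phi>_nonzero in auto)
  have "((\<lambda>\<zeta>. (1 / (2 * of_real a0 * of_real a1)) * (\<phi> \<zeta> powi k * poly q (\<phi> \<zeta>) * 1)
        + (1 / ?\<kappa>) * (\<phi> \<zeta> powi k * poly p (\<phi> \<zeta>) * \<zeta>))
      has_contour_integral (1 / (2 * of_real a0 * of_real a1)) * (\<Sum>i\<le>degree q. coeff q i * 0)
        + (1 / ?\<kappa>) * (\<Sum>i\<le>degree p. coeff p i * (?\<kappa> * circle_moment (k + int i)))) \<Gamma>"
    by (intro has_contour_integral_add has_contour_integral_lmul odd even)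
  moreover have "(1 / ?\<kappa>) * (\<Sum>i\<le>degree p. coeff p i * (?\<kappa> * circle_moment (k + int i))) = ?I"
    by (simp add: sum_distrib_left field_simps)
  ultimately have 2: "((\<lambda>\<zeta>. \<phi> \<zeta> powi k / (2 * of_real a0 * of_real a1) * (g (\<phi> \<zeta>) + \<zeta> / 2 * f (\<phi> \<zeta>)))
        has_contour_integral ?I) \<Gamma>"
    by (simp add: p q field_simps)
  from 1 2 show ?thesis unfolding p by auto
qed

lemma polynomial_entries_symbol: "polynomial_entries A"
  unfolding polynomial_entries_def forall_2 symbol_A_def
  by (simp add: polynomial_fun_intros)

text \<open>The integral formula on which everything rests. It is stated with a common value \<open>I\<close> of the two integrals
because the existence of both is needed later, not only their equality.\<close>

lemma pullback:
  assumes "polynomial_entries X" "polynomial_entries Y"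
  obtains I where
    "has_mat_contour_integral (\<lambda>z. z powi k \<cdot>\<^sub>C (X z ** mat_power (A z) m ** Y z)) I unit_circle"
    "has_mat_contour_integral (\<lambda>\<zeta>. (\<phi> \<zeta> powi k / (2 * of_real a0 * of_real a1) * eigval \<zeta> ^ m)
       \<cdot>\<^sub>C (X (\<phi> \<zeta>) ** Q \<zeta> ** Y (\<phi> \<zeta>))) I \<Gamma>"
proof -
  define B where "B z = A z + (- (of_real b0 + of_real b1) / 2) \<cdot>\<^sub>C mat 1" for z
  define F where "F z = X z ** mat_power (A z) m ** Y z" for z
  define G where "G z = X z ** mat_power (A z) m ** B z ** Y z" for z
  have B: "polynomial_entries B"
    using polynomial_entries_symbol unfolding B_def polynomial_entries_def
    by (simp add: polynomial_fun_add polynomial_fun_const)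
  have F: "polynomial_entries F" and G: "polynomial_entries G"
    unfolding F_def G_def
    by (intro polynomial_entries_mult polynomial_entries_mat_power polynomial_entries_symbol assms B)+
  \<comment> \<open>\<open>F\<close> is the integrand over the unit circle; \<open>A\<^sup>m Q = A\<^sup>m (B(\<phi>) + \<zeta> / 2)\<close> splits the other integrand.\<close>
  have split: "eigval \<zeta> ^ m \<cdot>\<^sub>C (X (\<phi> \<zeta>) ** Q \<zeta> ** Y (\<phi> \<zeta>)) = G (\<phi> \<zeta>) + (\<zeta> / 2) \<cdot>\<^sub>C F (\<phi> \<zeta>)" for \<zeta>
  proof -
    have "eigval \<zeta> ^ m \<cdot>\<^sub>C (X (\<phi> \<zeta>) ** Q \<zeta> ** Y (\<phi> \<zeta>))
        = X (\<phi> \<zeta>) ** (mat_power (A (\<phi> \<zeta>)) m ** Q \<zeta>) ** Y (\<phi> \<zeta>)"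
      by (simp add: symbol_power_mult_Q mat_scale_mult_left mat_scale_mult_right)
    also have "\<dots> = X (\<phi> \<zeta>) ** (mat_power (A (\<phi> \<zeta>)) m ** (B (\<phi> \<zeta>) + (\<zeta> / 2) \<cdot>\<^sub>C mat 1)) ** Y (\<phi> \<zeta>)"
      by (simp add: Q_eq_symbol B_def)
    finally show ?thesis
      by (simp add: F_def G_def matrix_add_ldistrib matrix_add_mult_distrib mat_scale_mult_left
          mat_scale_mult_right matrix_mul_assoc)
  qed
  have "\<forall>i j. \<exists>I. ((\<lambda>z. z powi k * F z $ i $ j) has_contour_integral I) unit_circle \<and>
     ((\<lambda>\<zeta>. \<phi> \<zeta> powi k / (2 * of_real a0 * of_real a1)
        * (G (\<phi> \<zeta>) $ i $ j + \<zeta> / 2 * F (\<phi> \<zeta>) $ i $ j)) has_contour_integral I) \<Gamma>"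
    using F G unfolding polynomial_entries_def by (intro allI pullback_scalar) auto
  then obtain I where
    I: "\<forall>i j. ((\<lambda>z. z powi k * F z $ i $ j) has_contour_integral I i j) unit_circle \<and>
      ((\<lambda>\<zeta>. \<phi> \<zeta> powi k / (2 * of_real a0 * of_real a1)
        * (G (\<phi> \<zeta>) $ i $ j + \<zeta> / 2 * F (\<phi> \<zeta>) $ i $ j)) has_contour_integral I i j) \<Gamma>"
    unfolding choice_iff by blast
  have "has_mat_contour_integral (\<lambda>z. z powi k \<cdot>\<^sub>C F z) (\<chi> i j. I i j) unit_circle"
    using I by (simp add: has_mat_contour_integral_def)
  moreover have "has_mat_contour_integral (\<lambda>\<zeta>. (\<phi> \<zeta> powi k / (2 * of_real a0 * of_real a1))
      \<cdot>\<^sub>C (G (\<phi> \<zeta>) + (\<zeta> / 2) \<cdot>\<^sub>C F (\<phi> \<zeta>))) (\<chi> i j. I i j) \<Gamma>"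
    using I by (simp add: has_mat_contour_integral_def)
  ultimately show ?thesis
    by (intro that[of "\<chi> i j. I i j"]) (simp_all only: F_def split flip: mat_scale_scale)
qed

section \<open>The scalar kernel of a matrix kernel\<close>

lemma square_eq_\<phi>: "\<zeta>\<^sup>2 = \<delta>\<^sup>2 + 4 * of_real a0 * of_real a1 * \<phi> \<zeta>"
  by (simp add: \<phi>_def)

text \<open>The scalar polynomials in \<open>\<zeta>\<close> are free over the polynomials in \<open>\<phi>(\<zeta>)\<close> with basis \<open>1, \<zeta>\<close>, hence also with
the entries of \<open>eigvec \<zeta>\<close> as basis. Thus rows of two polynomials of degree below \<open>n\<close> correspond to
scalar polynomials of degree below \<open>2 n\<close>.\<close>

lemma scalar_poly_eq_row_mult_eigvec:
  assumes p: "degree p < 2 * n"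
  obtains f g where "degree f < n" "degree g < n"
    "\<And>\<zeta>. poly p \<zeta> = poly f (\<phi> \<zeta>) * eigvec \<zeta> $ 1 + poly g (\<phi> \<zeta>) * eigvec \<zeta> $ 2"
proof -
  have n: "n > 0" using p by simp
  \<comment> \<open>\<open>t(\<phi>(\<zeta>)) = \<zeta>\<^sup>2\<close>, so \<open>E\<close> and \<open>F\<close> collect the even and the odd coefficients of \<open>p\<close>.\<close>
  define t where "t = [:\<delta>\<^sup>2, 4 * of_real a0 * of_real a1:]"
  define E where "E = (\<Sum>k<n. smult (coeff p (2 * k)) (t ^ k))"
  define F where "F = (\<Sum>k<n. smult (coeff p (2 * k + 1)) (t ^ k))"
  have t: "poly t (\<phi> \<zeta>) = \<zeta>\<^sup>2" for \<zeta>
    by (simp add: t_def square_eq_\<phi>[of \<zeta>] mult.commute)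
  have deg: "degree (t ^ k) \<le> k" for k
    using degree_power_le[of t k] by (simp add: t_def)
  have degE: "degree E < n" and degF: "degree F < n"
    unfolding E_def F_def using n deg
    by (auto intro!: degree_sum_less le_less_trans[OF degree_smult_le] intro: le_less_trans)
  have "poly p \<zeta> = poly E (\<phi> \<zeta>) + \<zeta> * poly F (\<phi> \<zeta>)" for \<zeta>
  proof -
    have "poly p \<zeta> = (\<Sum>i<2 * n. coeff p i * \<zeta> ^ i)"
      unfolding poly_altdef by (rule sum.mono_neutral_left) (use p in \<open>auto simp: coeff_eq_0\<close>)
    also have "\<dots> = (\<Sum>k<n. coeff p (2 * k) * (\<zeta>\<^sup>2) ^ k + \<zeta> * (coeff p (2 * k + 1) * (\<zeta>\<^sup>2) ^ k))"
      unfolding sum_even_odd by (intro sum.cong refl) (simp add: mult_ac flip: power_mult)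
    also have "\<dots> = poly E (\<phi> \<zeta>) + \<zeta> * poly F (\<phi> \<zeta>)"
      by (simp add: E_def F_def poly_sum t sum.distrib sum_distrib_left)
    finally show ?thesis .
  qed
  moreover have "poly (E + smult \<delta> F) z * eigvec \<zeta> $ 1
      + poly (smult (2 * of_real a0) F) z * eigvec \<zeta> $ 2 = poly E z + \<zeta> * poly F z" for z \<zeta>
  proof -
    have "2 * of_real a0 * poly F z * ((\<zeta> - \<delta>) / (2 * of_real a0)) = poly F z * (\<zeta> - \<delta>)"
      by simp
    then show ?thesis
      by (simp only: eigvec_nth poly_add poly_smult) (simp add: algebra_simps)
  qed
  moreover have "degree (E + smult \<delta> F) < n"
    by (intro degree_add_less degE le_less_trans[OF degree_smult_le degF])
  moreover have "degree (smult (2 * of_real a0) F) < n"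
    by (intro le_less_trans[OF degree_smult_le degF])
  ultimately show ?thesis using that[of "E + smult \<delta> F" "smult (2 * of_real a0) F"] by metis
qed

lemma degree_\<phi>_mult_linear:
  assumes "degree p < n" "degree l \<le> 1"
  shows "\<exists>q. degree q < 2 * n \<and> (\<forall>\<zeta>. poly p (\<phi> \<zeta>) * poly l \<zeta> = poly q \<zeta>)"
proof -
  let ?\<kappa> = "4 * of_real a0 * of_real a1 :: complex"
  \<comment> \<open>the polynomial \<open>\<phi>\<close>\<close>
  let ?s = "[:- \<delta>\<^sup>2 / ?\<kappa>, 0, 1 / ?\<kappa>:]"
  let ?q = "pcompose p ?s * l"
  have "degree ?s \<le> 2" by simp
  then have "degree (pcompose p ?s) \<le> degree p * 2"
    using degree_pcompose_le[of p ?s] by (meson le_trans mult_le_mono2)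
  then have "degree ?q \<le> degree p * 2 + 1"
    using degree_mult_le[of "pcompose p ?s" l] assms(2) by linarith
  then have "degree ?q < 2 * n" using assms(1) by linarith
  moreover have "poly ?s \<zeta> = \<phi> \<zeta>" for \<zeta>
    by (simp add: \<phi>_def power2_eq_square diff_divide_distrib)
  then have "poly p (\<phi> \<zeta>) * poly l \<zeta> = poly ?q \<zeta>" for \<zeta>
    by (simp only: poly_mult poly_pcompose)
  ultimately show ?thesis by blast
qed

lemma eigvec_poly: "\<exists>l. degree l \<le> 1 \<and> (\<forall>\<zeta>. eigvec \<zeta> $ i = poly l \<zeta>)"
proof (cases "i = 1")
  case True
  then show ?thesis by (intro exI[of _ 1]) simp
next
  case False
  then have "i = 2" using exhaust_2 by blast
  then show ?thesis
    by (intro exI[of _ "[:- \<delta> / (2 * of_real a0), 1 / (2 * of_real a0):]"])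
      (simp add: diff_divide_distrib)
qed

lemma coeigvec_poly: "\<exists>l. degree l \<le> 1 \<and> (\<forall>\<zeta>. coeigvec \<zeta> $ i = poly l \<zeta>)"
proof (cases "i = 1")
  case True
  then show ?thesis by (intro exI[of _ "[:\<delta> / 2, 1 / 2:]"]) (simp add: add_divide_distrib)
next
  case False
  then have "i = 2" using exhaust_2 by blast
  then show ?thesis by (intro exI[of _ "[:of_real a0:]"]) simp
qed

definition scalar_kernel :: "(complex \<Rightarrow> complex \<Rightarrow> complex^2^2) \<Rightarrow> complex \<Rightarrow> complex \<Rightarrow> complex" where
  "scalar_kernel R \<omega> \<zeta> =
     (\<Sum>i\<in>UNIV. \<Sum>j\<in>UNIV. coeigvec \<omega> $ i * R (\<phi> \<omega>) (\<phi> \<zeta>) $ i $ j * eigvec \<zeta> $ j)"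

lemma bivariate_poly_scalar_kernel:
  assumes "n > 0" "bivariate_matrix_poly n R"
  shows "bivariate_poly (2 * n) (scalar_kernel R)"
proof -
  obtain C where C: "\<And>w z. R w z = (\<Sum>k<n. \<Sum>l<n. (w ^ k * z ^ l) \<cdot>\<^sub>C C k l)"
    using assms(2) unfolding bivariate_matrix_poly_def by auto
  have "bivariate_poly (2 * n)
      (\<lambda>\<omega> \<zeta>. (\<phi> \<omega> ^ k * coeigvec \<omega> $ i) * C k l $ i $ j * (\<phi> \<zeta> ^ l * eigvec \<zeta> $ j))"
    if kl: "k < n" "l < n" for k l i j
  proof -
    have deg: "degree (monom 1 k :: complex poly) < n" if "k < n" for k
      using that le_less_trans[OF degree_monom_le] by blast
    obtain s t where s: "degree s \<le> 1" "\<And>\<zeta>. coeigvec \<zeta> $ i = poly s \<zeta>"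
      and t: "degree t \<le> 1" "\<And>\<zeta>. eigvec \<zeta> $ j = poly t \<zeta>"
      using eigvec_poly[of j] coeigvec_poly[of i] by blast
    obtain p q where p: "degree p < 2 * n" "\<And>\<zeta>. \<phi> \<zeta> ^ k * poly s \<zeta> = poly p \<zeta>"
      and q: "degree q < 2 * n" "\<And>\<zeta>. \<phi> \<zeta> ^ l * poly t \<zeta> = poly q \<zeta>"
      using degree_\<phi>_mult_linear[OF deg[OF kl(1)] s(1)] degree_\<phi>_mult_linear[OF deg[OF kl(2)] t(1)]
      by (auto simp: poly_monom)
    show ?thesis
      unfolding s(2) t(2) p(2) q(2) by (rule bivariate_poly_prod[OF p(1) q(1)])
  qed
  then have "bivariate_poly (2 * n) (\<lambda>\<omega> \<zeta>. \<Sum>i\<in>UNIV. \<Sum>j\<in>UNIV. \<Sum>k<n. \<Sum>l<n.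
      (\<phi> \<omega> ^ k * coeigvec \<omega> $ i) * C k l $ i $ j * (\<phi> \<zeta> ^ l * eigvec \<zeta> $ j))"
    by (intro bivariate_poly_sum) auto
  also have "(\<lambda>\<omega> \<zeta>. \<Sum>i\<in>UNIV. \<Sum>j\<in>UNIV. \<Sum>k<n. \<Sum>l<n.
      (\<phi> \<omega> ^ k * coeigvec \<omega> $ i) * C k l $ i $ j * (\<phi> \<zeta> ^ l * eigvec \<zeta> $ j)) = scalar_kernel R"
    by (simp add: fun_eq_iff scalar_kernel_def C sum_distrib_left sum_distrib_right mult_ac)
  finally show ?thesis .
qed

lemma sandwich_Q:
  "(X ** Q \<omega> ** Y) $ i $ j =
     (\<Sum>a\<in>UNIV. X $ i $ a * eigvec \<omega> $ a) * (\<Sum>b\<in>UNIV. coeigvec \<omega> $ b * Y $ b $ j)"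
  unfolding matrix_mult_nth Q_def sum_2 by (simp only: vec_lambda_beta) algebra

text \<open>The scalar weight is the factor that \<open>pullback\<close> produces from \<open>weight_W\<close>.\<close>

lemma weight_curly_W_eq:
  "weight_curly_W a0 a1 b0 b1 L M N \<omega> =
     \<phi> \<omega> powi (- int ((M + N) div 2)) / (2 * of_real a0 * of_real a1) * eigval \<omega> ^ L"
proof -
  have "4 * of_real a0 * of_real a1 / (\<omega>\<^sup>2 - \<delta>\<^sup>2) = inverse (\<phi> \<omega>)"
    by (simp add: \<phi>_def)
  then show ?thesis
    unfolding weight_curly_W_def eigval_def by (simp add: power_int_minus power_inverse)
qed

text \<open>Let \<open>P\<close> be the row with \<open>p(\<omega>) = P(\<phi>(\<omega>)) u(\<omega>)\<close>. By \<open>pullback\<close>, the reproducing property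
\<open>\<integral> P W R(\<cdot>,\<phi>(\<zeta>)) = P(\<phi>(\<zeta>))\<close> becomes an integral over the \<open>\<zeta>\<close>-plane of
\<open>P(\<phi>(\<omega>)) u(\<omega>) v(\<omega>)\<^sup>T R(\<phi>(\<omega>),\<phi>(\<zeta>))\<close> against the scalar weight. Multiplication by \<open>u(\<zeta>)\<close> from the right gives
\<open>p(\<omega>) r(\<omega>,\<zeta>)\<close> under the integral and \<open>p(\<zeta>)\<close> as its value.\<close>

lemma reproducing_scalar_kernel:
  assumes n: "n > 0" and R: "is_CD_kernel unit_circle (weight_W a0 a1 b0 b1 L M N) n R"
  shows "reproducing_kernel \<Gamma> (weight_curly_W a0 a1 b0 b1 L M N) (2 * n) (scalar_kernel R)"
  unfolding reproducing_kernel_def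
proof (intro conjI allI impI)
  let ?h = "int ((M + N) div 2)"
  have biv: "bivariate_matrix_poly n R" using R unfolding is_CD_kernel_def by blast
  then show "bivariate_poly (2 * n) (scalar_kernel R)"
    by (rule bivariate_poly_scalar_kernel[OF n])
  fix p :: "complex poly" and \<zeta> assume "degree p < 2 * n"
  then obtain f g where fg: "degree f < n" "degree g < n"
    and p: "\<And>\<zeta>. poly p \<zeta> = poly f (\<phi> \<zeta>) * eigvec \<zeta> $ 1 + poly g (\<phi> \<zeta>) * eigvec \<zeta> $ 2"
    by (rule scalar_poly_eq_row_mult_eigvec) blast
  \<comment> \<open>The kernel is tested with square matrices; only the first row carries information.\<close>
  define P where "P z = mat2 (poly f z) (poly g z) 0 0" for z
  have P: "matrix_poly n P"
    using fg n unfolding matrix_poly_iff_entries[OF n] forall_2 P_def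
    by (auto intro: exI[of _ 0])
  have row: "(\<Sum>a\<in>UNIV. P (\<phi> \<omega>) $ 1 $ a * eigvec \<omega> $ a) = poly p \<omega>" for \<omega>
    by (simp only: P_def sum_2 mat2_nth p)
  let ?Y = "\<lambda>w. R w (\<phi> \<zeta>)"
  obtain I where
    I1: "has_mat_contour_integral (\<lambda>z. z powi (- ?h) \<cdot>\<^sub>C (P z ** mat_power (A z) L ** ?Y z)) I unit_circle"
    and I2: "has_mat_contour_integral
      (\<lambda>\<omega>. (\<phi> \<omega> powi (- ?h) / (2 * of_real a0 * of_real a1) * eigval \<omega> ^ L)
         \<cdot>\<^sub>C (P (\<phi> \<omega>) ** Q \<omega> ** ?Y (\<phi> \<omega>))) I \<Gamma>"
    by (rule pullback[OF matrix_poly_polynomial_entries[OF P] polynomial_entries_section(1)[OF n biv]])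
  have "has_mat_contour_integral (\<lambda>w. P w ** weight_W a0 a1 b0 b1 L M N w ** ?Y w) (P (\<phi> \<zeta>)) unit_circle"
    using R P unfolding is_CD_kernel_def by blast
  then have "I = P (\<phi> \<zeta>)"
    using has_mat_contour_integral_unique[OF I1]
    by (simp add: weight_W_def mat_scale_mult_left mat_scale_mult_right)
  with I2 have "((\<lambda>\<omega>. weight_curly_W a0 a1 b0 b1 L M N \<omega> * (P (\<phi> \<omega>) ** Q \<omega> ** ?Y (\<phi> \<omega>)) $ 1 $ j)
      has_contour_integral P (\<phi> \<zeta>) $ 1 $ j) \<Gamma>" for j
    unfolding has_mat_contour_integral_def weight_curly_W_eq by simp
  then have "((\<lambda>\<omega>. \<Sum>j\<in>UNIV. weight_curly_W a0 a1 b0 b1 L M N \<omega>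
        * (P (\<phi> \<omega>) ** Q \<omega> ** ?Y (\<phi> \<omega>)) $ 1 $ j * eigvec \<zeta> $ j)
      has_contour_integral (\<Sum>j\<in>UNIV. P (\<phi> \<zeta>) $ 1 $ j * eigvec \<zeta> $ j)) \<Gamma>"
    by (intro has_contour_integral_sum has_contour_integral_rmul) auto
  moreover have "(\<Sum>j\<in>UNIV. v * (poly p \<omega> * (\<Sum>b\<in>UNIV. coeigvec \<omega> $ b * ?Y (\<phi> \<omega>) $ b $ j)) * eigvec \<zeta> $ j)
      = poly p \<omega> * v * scalar_kernel R \<omega> \<zeta>" for \<omega> v
    unfolding scalar_kernel_def sum_2 by algebra
  ultimately show "((\<lambda>\<omega>. poly p \<omega> * weight_curly_W a0 a1 b0 b1 L M N \<omega> * scalar_kernel R \<omega> \<zeta>)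
      has_contour_integral poly p \<zeta>) \<Gamma>"
    by (simp only: sandwich_Q row)
qed

text \<open>The eigenvectors of the two sheets over a point are linearly independent away from the branch point
\<open>\<zeta> = 0\<close>; likewise for the next lemma.\<close>

lemma coeigvec_separates:
  assumes "\<omega> \<noteq> 0" "coeigvec \<omega> $ 1 * x + coeigvec \<omega> $ 2 * y = 0"
    and "coeigvec (- \<omega>) $ 1 * x + coeigvec (- \<omega>) $ 2 * y = 0"
  shows "x = 0 \<and> y = 0"
proof -
  have "\<omega> * x = (coeigvec \<omega> $ 1 * x + coeigvec \<omega> $ 2 * y) - (coeigvec (- \<omega>) $ 1 * x + coeigvec (- \<omega>) $ 2 * y)"
    by (simp add: field_simps)
  also have "\<dots> = 0" unfolding assms(2,3) by simp
  finally have "x = 0" using assms(1) by simp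
  with assms(2) show ?thesis by simp
qed

lemma eigvec_separates:
  assumes "\<zeta> \<noteq> 0" "x * eigvec \<zeta> $ 1 + y * eigvec \<zeta> $ 2 = 0"
    and "x * eigvec (- \<zeta>) $ 1 + y * eigvec (- \<zeta>) $ 2 = 0"
  shows "x = 0 \<and> y = 0"
proof -
  have "y * \<zeta> / of_real a0 = (x * eigvec \<zeta> $ 1 + y * eigvec \<zeta> $ 2) - (x * eigvec (- \<zeta>) $ 1 + y * eigvec (- \<zeta>) $ 2)"
    by (simp add: field_simps)
  also have "\<dots> = 0" unfolding assms(2,3) by simp
  finally have "y = 0" using assms(1) by simp
  with assms(2) show ?thesis by simp
qed

lemma \<phi>_two_preimages:
  assumes "w \<noteq> \<phi> 0"
  obtains \<omega> where "\<omega> \<noteq> 0" "\<phi> \<omega> = w" "\<phi> (- \<omega>) = w"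
proof -
  define \<omega> where "\<omega> = csqrt (\<delta>\<^sup>2 + 4 * of_real a0 * of_real a1 * w)"
  have "\<omega>\<^sup>2 = \<delta>\<^sup>2 + 4 * of_real a0 * of_real a1 * w" by (simp add: \<omega>_def)
  then have "\<phi> \<omega> = w" "\<phi> (- \<omega>) = w" by (simp_all add: \<phi>_def)
  moreover from this assms have "\<omega> \<noteq> 0" by auto
  ultimately show ?thesis using that by blast
qed

text \<open>Over points \<open>w, z\<close> that are not the branch value \<open>\<phi> 0\<close>, the four values of the scalar kernel at the
preimages \<open>\<plusminus>\<omega>, \<plusminus>\<zeta>\<close> determine the \<open>2 \<times> 2\<close> matrix \<open>R w z\<close>. The branch value is covered because the entries are
polynomials.\<close>

lemma scalar_kernel_inject:
  assumes n: "n > 0" and biv: "bivariate_matrix_poly n R1" "bivariate_matrix_poly n R2"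
    and eq: "scalar_kernel R1 = scalar_kernel R2"
  shows "R1 = R2"
proof -
  have "R1 w z $ i $ j = R2 w z $ i $ j" if "w \<noteq> \<phi> 0" "z \<noteq> \<phi> 0" for w z i j
  proof -
    obtain \<omega> where \<omega>: "\<omega> \<noteq> 0" "\<phi> \<omega> = w" "\<phi> (- \<omega>) = w" using \<phi>_two_preimages[OF \<open>w \<noteq> \<phi> 0\<close>] .
    obtain \<zeta> where \<zeta>: "\<zeta> \<noteq> 0" "\<phi> \<zeta> = z" "\<phi> (- \<zeta>) = z" using \<phi>_two_preimages[OF \<open>z \<noteq> \<phi> 0\<close>] .
    define D where "D = R1 w z - R2 w z"
    \<comment> \<open>The difference matrix \<open>D\<close> is eliminated one side at a time: first the left eigenvectors, then the right ones.\<close>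
    define e where "e \<zeta> i = D $ i $ 1 * eigvec \<zeta> $ 1 + D $ i $ 2 * eigvec \<zeta> $ 2" for \<zeta> i
    have row: "coeigvec \<omega>' $ 1 * e \<zeta>' 1 + coeigvec \<omega>' $ 2 * e \<zeta>' 2 = 0"
      if "\<phi> \<omega>' = w" "\<phi> \<zeta>' = z" for \<omega>' \<zeta>'
    proof -
      have "coeigvec \<omega>' $ 1 * e \<zeta>' 1 + coeigvec \<omega>' $ 2 * e \<zeta>' 2
          = scalar_kernel R1 \<omega>' \<zeta>' - scalar_kernel R2 \<omega>' \<zeta>'"
        unfolding scalar_kernel_def that sum_2 e_def D_def vector_minus_component by algebra
      then show ?thesis by (simp add: eq)
    qed
    have "e \<zeta> 1 = 0 \<and> e \<zeta> 2 = 0" "e (- \<zeta>) 1 = 0 \<and> e (- \<zeta>) 2 = 0"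
      using coeigvec_separates[OF \<omega>(1) row row] \<omega> \<zeta> by blast+
    then have e: "e \<zeta> i = 0" "e (- \<zeta>) i = 0" for i
      using exhaust_2[of i] by auto
    have "D $ i $ 1 = 0 \<and> D $ i $ 2 = 0" for i
      using eigvec_separates[OF \<zeta>(1)] e[of i] unfolding e_def by blast
    then have "D $ i $ j = 0" using exhaust_2[of j] by auto
    then show ?thesis by (simp add: D_def)
  qed
  then have "R1 w z $ i $ j = R2 w z $ i $ j" for w z i j
    using bivariate_poly_eq_except_point[OF n, of "\<lambda>w z. R1 w z $ i $ j" "\<lambda>w z. R2 w z $ i $ j" "\<phi> 0"] biv
    unfolding bivariate_matrix_poly_iff_entries by blast
  then show ?thesis by (simp add: fun_eq_iff vec_eq_iff)
qed

text \<open>The matrix weight is not symmetric, which rules out the argument used for scalar weights; uniqueness is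
inherited from the scalar kernel instead.\<close>

lemma matrix_CD_kernel_eq:
  assumes n: "n > 0" and R: "is_CD_kernel unit_circle (weight_W a0 a1 b0 b1 L M N) n R"
  shows "CD_kernel unit_circle (weight_W a0 a1 b0 b1 L M N) n = R"
  unfolding CD_kernel_def
proof (rule the_equality)
  show "is_CD_kernel unit_circle (weight_W a0 a1 b0 b1 L M N) n R" by (rule R)
next
  fix R' assume R': "is_CD_kernel unit_circle (weight_W a0 a1 b0 b1 L M N) n R'"
  have "scalar_kernel R' = scalar_kernel R"
    by (rule reproducing_kernel_unique[OF _ reproducing_scalar_kernel[OF n R'] reproducing_scalar_kernel[OF n R]])
      (use n in simp)
  then show "R' = R"
    using scalar_kernel_inject[OF n] R R' unfolding is_CD_kernel_def by blast
qed

section \<open>Transfer of the integrals\<close>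

lemma single_integral_eq:
  "mat_contour_integral unit_circle (\<lambda>z. z powi k \<cdot>\<^sub>C mat_power (A z) m) =
   mat_contour_integral \<Gamma> (\<lambda>\<zeta>. (\<phi> \<zeta> powi k / (2 * of_real a0 * of_real a1) * eigval \<zeta> ^ m) \<cdot>\<^sub>C Q \<zeta>)"
proof -
  obtain I where
    "has_mat_contour_integral (\<lambda>z. z powi k \<cdot>\<^sub>C (mat 1 ** mat_power (A z) m ** mat 1)) I unit_circle"
    "has_mat_contour_integral (\<lambda>\<zeta>. (\<phi> \<zeta> powi k / (2 * of_real a0 * of_real a1) * eigval \<zeta> ^ m)
       \<cdot>\<^sub>C (mat 1 ** Q \<zeta> ** mat 1)) I \<Gamma>"
    by (rule pullback[OF polynomial_entries_const polynomial_entries_const])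
  then show ?thesis by (simp add: mat_contour_integral_unique)
qed

lemma Q_mult_Q: "Q \<omega> ** (R (\<phi> \<omega>) (\<phi> \<zeta>) ** Q \<zeta>) =
    scalar_kernel R \<omega> \<zeta> \<cdot>\<^sub>C (\<chi> i j. eigvec \<omega> $ i * coeigvec \<zeta> $ j)"
  unfolding vec_eq_iff
proof (intro allI)
  fix i j
  show "(Q \<omega> ** (R (\<phi> \<omega>) (\<phi> \<zeta>) ** Q \<zeta>)) $ i $ j =
      (scalar_kernel R \<omega> \<zeta> \<cdot>\<^sub>C (\<chi> i j. eigvec \<omega> $ i * coeigvec \<zeta> $ j)) $ i $ j"
    unfolding matrix_mult_nth mat_scale_nth Q_def scalar_kernel_def sum_2 vec_lambda_beta by algebra
qed

text \<open>After the integration in \<open>z\<close>, the double integral is again of the form to which \<open>pullback\<close> applies in \<open>w\<close>.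
The factor \<open>mat 1\<close> is the trivial right factor \<open>Y\<close> of \<open>pullback\<close>.\<close>

lemma polynomial_entries_integral:
  assumes biv: "bivariate_matrix_poly n R"
  shows "polynomial_entries (\<lambda>w. mat_contour_integral unit_circle
           (\<lambda>z. z powi k \<cdot>\<^sub>C (R w z ** mat_power (A z) m ** mat 1)))"
proof -
  obtain C where C: "\<And>w z. R w z = (\<Sum>i<n. \<Sum>j<n. (w ^ i * z ^ j) \<cdot>\<^sub>C C i j)"
    using biv unfolding bivariate_matrix_poly_def by auto
  define E where "E i j = mat_contour_integral unit_circle
      (\<lambda>z. z powi k \<cdot>\<^sub>C ((z ^ j \<cdot>\<^sub>C C i j) ** mat_power (A z) m ** mat 1))" for i j
  have E: "has_mat_contour_integral
      (\<lambda>z. z powi k \<cdot>\<^sub>C ((z ^ j \<cdot>\<^sub>C C i j) ** mat_power (A z) m ** mat 1)) (E i j) unit_circle" for i j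
  proof -
    have X: "polynomial_entries (\<lambda>z. z ^ j \<cdot>\<^sub>C C i j)"
      by (intro polynomial_entries_scale polynomial_fun_intros)
    obtain I where I: "has_mat_contour_integral
        (\<lambda>z. z powi k \<cdot>\<^sub>C ((z ^ j \<cdot>\<^sub>C C i j) ** mat_power (A z) m ** mat 1)) I unit_circle"
      by (rule pullback[OF X polynomial_entries_const])
    with mat_contour_integral_unique[OF I] show ?thesis by (simp only: E_def)
  qed
  have "mat_contour_integral unit_circle (\<lambda>z. z powi k \<cdot>\<^sub>C (R w z ** mat_power (A z) m ** mat 1))
      = (\<Sum>i<n. \<Sum>j<n. w ^ i \<cdot>\<^sub>C E i j)" for w
  proof (rule mat_contour_integral_unique)
    have "has_mat_contour_integral (\<lambda>z. \<Sum>i<n. \<Sum>j<n.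
          w ^ i \<cdot>\<^sub>C (z powi k \<cdot>\<^sub>C ((z ^ j \<cdot>\<^sub>C C i j) ** mat_power (A z) m ** mat 1)))
        (\<Sum>i<n. \<Sum>j<n. w ^ i \<cdot>\<^sub>C E i j) unit_circle"
      by (intro has_mat_contour_integral_sum has_mat_contour_integral_scale E) auto
    also have "(\<lambda>z. \<Sum>i<n. \<Sum>j<n.
          w ^ i \<cdot>\<^sub>C (z powi k \<cdot>\<^sub>C ((z ^ j \<cdot>\<^sub>C C i j) ** mat_power (A z) m ** mat 1)))
        = (\<lambda>z. z powi k \<cdot>\<^sub>C (R w z ** mat_power (A z) m ** mat 1))"
    proof
      fix z
      have mult: "(\<Sum>i<n. \<Sum>j<n. (z powi k * w ^ i * z ^ j) * (C i j ** B) $ a $ b)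
          = z powi k * (R w z ** B) $ a $ b" for B :: "complex^2^2" and a b
      proof -
        have "(R w z ** B) $ a $ b
            = (\<Sum>c\<in>UNIV. \<Sum>i<n. \<Sum>j<n. w ^ i * z ^ j * (C i j $ a $ c * B $ c $ b))"
          by (simp add: matrix_mult_nth C sum_distrib_right mult.assoc)
        also have "\<dots> = (\<Sum>i<n. \<Sum>j<n. \<Sum>c\<in>UNIV. w ^ i * z ^ j * (C i j $ a $ c * B $ c $ b))"
          by (subst sum.swap) (intro sum.cong refl sum.swap)
        finally show ?thesis
          by (simp add: matrix_mult_nth sum_distrib_left mult.assoc)
      qed
      from mult[where B = "mat_power (A z) m"]
      show "(\<Sum>i<n. \<Sum>j<n.
            w ^ i \<cdot>\<^sub>C (z powi k \<cdot>\<^sub>C ((z ^ j \<cdot>\<^sub>C C i j) ** mat_power (A z) m ** mat 1)))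
          = z powi k \<cdot>\<^sub>C (R w z ** mat_power (A z) m ** mat 1)"
        by (simp add: vec_eq_iff mat_scale_mult_left mult_ac)
    qed
    finally show "has_mat_contour_integral
        (\<lambda>z. z powi k \<cdot>\<^sub>C (R w z ** mat_power (A z) m ** mat 1))
        (\<Sum>i<n. \<Sum>j<n. w ^ i \<cdot>\<^sub>C E i j) unit_circle" .
  qed
  then show ?thesis
    unfolding polynomial_entries_def by (simp add: polynomial_fun_intros)
qed

text \<open>Two applications of \<open>pullback\<close>, first in \<open>z\<close> for each fixed \<open>w\<close>, with value \<open>G w\<close>, and then in \<open>w\<close> with
\<open>G\<close> as the right factor.\<close>

lemma double_integral_eq:
  assumes n: "n > 0" and biv: "bivariate_matrix_poly n R"
  shows "mat_contour_integral unit_circle (\<lambda>w. mat_contour_integral unit_circle (\<lambda>z.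
            (1 / (w powi a * z powi b)) \<cdot>\<^sub>C (mat_power (A w) m ** R w z ** mat_power (A z) m')))
       = mat_contour_integral \<Gamma> (\<lambda>\<omega>. mat_contour_integral \<Gamma> (\<lambda>\<zeta>.
            (scalar_kernel R \<omega> \<zeta> * eigval \<zeta> ^ m' * eigval \<omega> ^ m / (\<phi> \<zeta> powi b * \<phi> \<omega> powi a)
               * (1 / (4 * (of_real a0)\<^sup>2 * (of_real a1)\<^sup>2)))
            \<cdot>\<^sub>C (\<chi> i j. eigvec \<omega> $ i * coeigvec \<zeta> $ j)))"
proof -
  let ?c = "2 * of_real a0 * of_real a1 :: complex"
  define G where "G w = mat_contour_integral unit_circle
      (\<lambda>z. z powi (- b) \<cdot>\<^sub>C (R w z ** mat_power (A z) m' ** mat 1))" for w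
  have G: "polynomial_entries G"
    unfolding G_def by (rule polynomial_entries_integral[OF biv])
  have inner: "has_mat_contour_integral
        (\<lambda>z. z powi (- b) \<cdot>\<^sub>C (R w z ** mat_power (A z) m' ** mat 1)) (G w) unit_circle"
      "has_mat_contour_integral (\<lambda>\<zeta>. (\<phi> \<zeta> powi (- b) / ?c * eigval \<zeta> ^ m')
        \<cdot>\<^sub>C (R w (\<phi> \<zeta>) ** Q \<zeta> ** mat 1)) (G w) \<Gamma>" for w
  proof -
    obtain I where
      I: "has_mat_contour_integral
          (\<lambda>z. z powi (- b) \<cdot>\<^sub>C (R w z ** mat_power (A z) m' ** mat 1)) I unit_circle"
        "has_mat_contour_integral (\<lambda>\<zeta>. (\<phi> \<zeta> powi (- b) / ?c * eigval \<zeta> ^ m')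
          \<cdot>\<^sub>C (R w (\<phi> \<zeta>) ** Q \<zeta> ** mat 1)) I \<Gamma>"
      by (rule pullback[OF polynomial_entries_section(2)[OF n biv] polynomial_entries_const])
    moreover have "G w = I"
      unfolding G_def by (rule mat_contour_integral_unique[OF I(1)])
    ultimately show "has_mat_contour_integral
        (\<lambda>z. z powi (- b) \<cdot>\<^sub>C (R w z ** mat_power (A z) m' ** mat 1)) (G w) unit_circle"
      "has_mat_contour_integral (\<lambda>\<zeta>. (\<phi> \<zeta> powi (- b) / ?c * eigval \<zeta> ^ m')
        \<cdot>\<^sub>C (R w (\<phi> \<zeta>) ** Q \<zeta> ** mat 1)) (G w) \<Gamma>" by simp_all
  qed
  have left: "mat_contour_integral unit_circle (\<lambda>z.
        (1 / (w powi a * z powi b)) \<cdot>\<^sub>C (mat_power (A w) m ** R w z ** mat_power (A z) m'))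
      = w powi (- a) \<cdot>\<^sub>C (mat 1 ** mat_power (A w) m ** G w)" for w
  proof -
    have "1 / (w powi a * z powi b) = w powi (- a) * z powi (- b)" for z :: complex
      by (simp add: power_int_minus inverse_eq_divide)
    then show ?thesis
      using mat_contour_integral_unique[OF has_mat_contour_integral_scale[OF
          has_mat_contour_integral_mult_left[OF inner(1)]], of "w powi (- a)" "mat_power (A w) m" w]
      by (simp add: mat_scale_mult_left mat_scale_mult_right mat_scale_scale matrix_mul_assoc)
  qed
  have right: "mat_contour_integral \<Gamma> (\<lambda>\<zeta>.
        (scalar_kernel R \<omega> \<zeta> * eigval \<zeta> ^ m' * eigval \<omega> ^ m / (\<phi> \<zeta> powi b * \<phi> \<omega> powi a)
           * (1 / (4 * (of_real a0)\<^sup>2 * (of_real a1)\<^sup>2)))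
        \<cdot>\<^sub>C (\<chi> i j. eigvec \<omega> $ i * coeigvec \<zeta> $ j))
      = (\<phi> \<omega> powi (- a) / ?c * eigval \<omega> ^ m) \<cdot>\<^sub>C (mat 1 ** Q \<omega> ** G (\<phi> \<omega>))" for \<omega>
  proof (rule mat_contour_integral_unique)
    have coeff: "(\<phi> \<omega> powi (- a) / ?c * eigval \<omega> ^ m) * ((\<phi> \<zeta> powi (- b) / ?c * eigval \<zeta> ^ m') * s)
        = s * eigval \<zeta> ^ m' * eigval \<omega> ^ m / (\<phi> \<zeta> powi b * \<phi> \<omega> powi a)
           * (1 / (4 * (of_real a0)\<^sup>2 * (of_real a1)\<^sup>2))" for \<zeta> s
      by (simp add: power_int_minus inverse_eq_divide power2_eq_square mult_ac)
    have "(\<phi> \<omega> powi (- a) / ?c * eigval \<omega> ^ m) \<cdot>\<^sub>C (Q \<omega> **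
        ((\<phi> \<zeta> powi (- b) / ?c * eigval \<zeta> ^ m') \<cdot>\<^sub>C (R (\<phi> \<omega>) (\<phi> \<zeta>) ** Q \<zeta> ** mat 1)))
      = (scalar_kernel R \<omega> \<zeta> * eigval \<zeta> ^ m' * eigval \<omega> ^ m / (\<phi> \<zeta> powi b * \<phi> \<omega> powi a)
           * (1 / (4 * (of_real a0)\<^sup>2 * (of_real a1)\<^sup>2)))
        \<cdot>\<^sub>C (\<chi> i j. eigvec \<omega> $ i * coeigvec \<zeta> $ j)" for \<zeta>
      by (simp only: matrix_mul_rid mat_scale_mult_right Q_mult_Q mat_scale_scale coeff)
    with has_mat_contour_integral_scale[OF has_mat_contour_integral_mult_left[OF inner(2)],
        of "\<phi> \<omega> powi (- a) / ?c * eigval \<omega> ^ m" "Q \<omega>" "\<phi> \<omega>"]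
    show "has_mat_contour_integral (\<lambda>\<zeta>.
        (scalar_kernel R \<omega> \<zeta> * eigval \<zeta> ^ m' * eigval \<omega> ^ m / (\<phi> \<zeta> powi b * \<phi> \<omega> powi a)
           * (1 / (4 * (of_real a0)\<^sup>2 * (of_real a1)\<^sup>2)))
        \<cdot>\<^sub>C (\<chi> i j. eigvec \<omega> $ i * coeigvec \<zeta> $ j))
      ((\<phi> \<omega> powi (- a) / ?c * eigval \<omega> ^ m) \<cdot>\<^sub>C (mat 1 ** Q \<omega> ** G (\<phi> \<omega>))) \<Gamma>"
      by (simp only: matrix_mul_lid)
  qed
  obtain I where
    "has_mat_contour_integral (\<lambda>w. w powi (- a) \<cdot>\<^sub>C (mat 1 ** mat_power (A w) m ** G w)) I unit_circle"
    "has_mat_contour_integral (\<lambda>\<omega>. (\<phi> \<omega> powi (- a) / ?c * eigval \<omega> ^ m)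
       \<cdot>\<^sub>C (mat 1 ** Q \<omega> ** G (\<phi> \<omega>))) I \<Gamma>"
    by (rule pullback[OF polynomial_entries_const G])
  then show ?thesis unfolding left right by (simp only: mat_contour_integral_unique)
qed

lemma Q_eq_mat2:
  "Q \<zeta> = mat2 ((\<zeta> - of_real b1 + of_real b0) / 2) (of_real a0)
     ((\<zeta>\<^sup>2 - (of_real b1 - of_real b0)\<^sup>2) / (4 * of_real a0)) ((\<zeta> + of_real b1 - of_real b0) / 2)"
  by (simp add: vec_eq_iff forall_2 Q_def) (simp add: field_simps power2_eq_square)

lemma dyad_eq_mat2:
  "(\<chi> i j. eigvec \<omega> $ i * coeigvec \<zeta> $ j) =
     mat2 ((\<zeta> - (of_real b1 - of_real b0)) / 2) (of_real a0)
       ((\<zeta> - of_real b1 + of_real b0) * (\<omega> + of_real b1 - of_real b0) / (4 * of_real a0))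
       ((\<omega> + of_real b1 - of_real b0) / 2)"
  by (simp add: vec_eq_iff forall_2) (simp add: field_simps)

lemma \<phi>_eq:
  "\<phi> \<zeta> = (\<zeta>\<^sup>2 - (of_real b1 - of_real b0)\<^sup>2) / (4 * of_real a1 * of_real a0)"
  by (simp add: \<phi>_def power2_commute mult_ac)

end

lemma mat2_kernel_K:
  "mat2
     (kernel_K a0 a1 b0 b1 L M N x1 (2 * y1) x2 (2 * y2))
     (kernel_K a0 a1 b0 b1 L M N x1 (2 * y1 + 1) x2 (2 * y2))
     (kernel_K a0 a1 b0 b1 L M N x1 (2 * y1) x2 (2 * y2 + 1))
     (kernel_K a0 a1 b0 b1 L M N x1 (2 * y1 + 1) x2 (2 * y2 + 1))
   = Duits_Kuijlaars_block a0 a1 b0 b1 L M N x1 y1 x2 y2"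
proof -
  have "(2 * y + 1) div 2 = y" for y :: int by presburger
  then show ?thesis by (simp add: vec_eq_iff forall_2 kernel_K_def)
qed

section \<open>The double contour integral formula\<close>

theorem theorem2p6:
  fixes a0 a1 b0 b1 :: real
    and L M N x1 x2 :: nat
    and y1 y2 :: int
    and c :: complex and r :: real
  assumes "a0 > 0" "a1 > 0" "b0 > 0" "b1 > 0"
    and "L > 0" "M > 0" "N > 0" "even M" "even N"
    and W_kernel_exists:
      "\<exists>R. is_CD_kernel unit_circle (weight_W a0 a1 b0 b1 L M N) (N div 2) R"
    and "x1 \<in> {1..L - 1}" "x2 \<in> {1..L - 1}"
    and "r > 0" "of_real (b0 - b1) \<in> ball c r" "of_real (b1 - b0) \<in> ball c r"
  shows
    "(\<exists>!R. is_CD_kernel (circlepath c r) (scalar_weight (weight_curly_W a0 a1 b0 b1 L M N)) N R)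
     \<and>
     mat2
       (kernel_K a0 a1 b0 b1 L M N x1 (2 * y1) x2 (2 * y2))
       (kernel_K a0 a1 b0 b1 L M N x1 (2 * y1 + 1) x2 (2 * y2))
       (kernel_K a0 a1 b0 b1 L M N x1 (2 * y1) x2 (2 * y2 + 1))
       (kernel_K a0 a1 b0 b1 L M N x1 (2 * y1 + 1) x2 (2 * y2 + 1))
     =
     - ((of_bool (x1 > x2) / (2 * of_real pi * \<i>)) \<cdot>\<^sub>C
         mat_contour_integral (circlepath c r) (\<lambda>\<zeta>.
           (((of_real b0 + of_real b1 + \<zeta>) / 2) ^ (x1 - x2)
             / ((\<zeta>\<^sup>2 - (of_real b0 - of_real b1)\<^sup>2) / (4 * of_real a0 * of_real a1)) powi (y1 - y2 + 1)
             * (1 / (2 * of_real a0 * of_real a1)))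
           \<cdot>\<^sub>C mat2
             ((\<zeta> - of_real b1 + of_real b0) / 2)
             (of_real a0)
             ((\<zeta>\<^sup>2 - (of_real b1 - of_real b0)\<^sup>2) / (4 * of_real a0))
             ((\<zeta> + of_real b1 - of_real b0) / 2)))
     + (1 / (2 * of_real pi * \<i>)) \<cdot>\<^sub>C
         mat_contour_integral (circlepath c r) (\<lambda>\<omega>.
           mat_contour_integral (circlepath c r) (\<lambda>\<zeta>.
             (scalar_CD_kernel (circlepath c r) (weight_curly_W a0 a1 b0 b1 L M N) N \<omega> \<zeta>
               * ((of_real b0 + of_real b1 + \<zeta>) / 2) ^ x1
               * ((of_real b0 + of_real b1 + \<omega>) / 2) ^ (L - x2)
               / (((\<zeta>\<^sup>2 - (of_real b1 - of_real b0)\<^sup>2) / (4 * of_real a1 * of_real a0)) powi (y1 + 1)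
                  * ((\<omega>\<^sup>2 - (of_real b1 - of_real b0)\<^sup>2) / (4 * of_real a1 * of_real a0))
                      powi (int ((M + N) div 2) - y2))
               * (1 / (4 * (of_real a0)\<^sup>2 * (of_real a1)\<^sup>2)))
             \<cdot>\<^sub>C mat2
               ((\<zeta> - (of_real b1 - of_real b0)) / 2)
               (of_real a0)
               ((\<zeta> - of_real b1 + of_real b0) * (\<omega> + of_real b1 - of_real b0) / (4 * of_real a0))
               ((\<omega> + of_real b1 - of_real b0) / 2)))"
proof -
  interpret spectral_curve a0 a1 b0 b1 c r
    by unfold_locales (use assms in auto)
  let ?n = "N div 2" and ?h = "int ((M + N) div 2)"
  have n: "?n > 0" and N: "2 * ?n = N" using \<open>N > 0\<close> \<open>even N\<close> by auto
  obtain R where R: "is_CD_kernel unit_circle (weight_W a0 a1 b0 b1 L M N) ?n R"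
    using W_kernel_exists by blast
  then have biv: "bivariate_matrix_poly ?n R" unfolding is_CD_kernel_def by blast
  have rep: "reproducing_kernel \<Gamma> (weight_curly_W a0 a1 b0 b1 L M N) N (scalar_kernel R)"
    using reproducing_scalar_kernel[OF n R] by (simp only: N)
  note scalar = scalar_CD_kernel_unique[OF \<open>N > 0\<close> rep]
  have single: "mat_contour_integral unit_circle
        (\<lambda>z. z powi (y2 - y1 - 1) \<cdot>\<^sub>C mat_power (A z) (x1 - x2))
      = mat_contour_integral \<Gamma> (\<lambda>\<zeta>. (eigval \<zeta> ^ (x1 - x2) / \<phi> \<zeta> powi (y1 - y2 + 1)
          * (1 / (2 * of_real a0 * of_real a1))) \<cdot>\<^sub>C Q \<zeta>)"
  proof -
    have "\<phi> \<zeta> powi (y2 - y1 - 1) / (2 * of_real a0 * of_real a1) * e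
        = e / \<phi> \<zeta> powi (y1 - y2 + 1) * (1 / (2 * of_real a0 * of_real a1))" for \<zeta> e
    proof -
      have "y2 - y1 - 1 = - (y1 - y2 + 1)" by simp
      then show ?thesis by (simp only: power_int_minus) (simp add: inverse_eq_divide mult_ac)
    qed
    then show ?thesis unfolding single_integral_eq by (simp only:)
  qed
  have block: "Duits_Kuijlaars_block a0 a1 b0 b1 L M N x1 y1 x2 y2 =
      - ((of_bool (x1 > x2) / (2 * of_real pi * \<i>)) \<cdot>\<^sub>C
          mat_contour_integral \<Gamma> (\<lambda>\<zeta>. (eigval \<zeta> ^ (x1 - x2) / \<phi> \<zeta> powi (y1 - y2 + 1)
            * (1 / (2 * of_real a0 * of_real a1))) \<cdot>\<^sub>C Q \<zeta>))
      + (1 / (2 * of_real pi * \<i>)) \<cdot>\<^sub>C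
          mat_contour_integral \<Gamma> (\<lambda>\<omega>. mat_contour_integral \<Gamma> (\<lambda>\<zeta>.
            (scalar_kernel R \<omega> \<zeta> * eigval \<zeta> ^ x1 * eigval \<omega> ^ (L - x2)
               / (\<phi> \<zeta> powi (y1 + 1) * \<phi> \<omega> powi (?h - y2))
               * (1 / (4 * (of_real a0)\<^sup>2 * (of_real a1)\<^sup>2)))
            \<cdot>\<^sub>C (\<chi> i j. eigvec \<omega> $ i * coeigvec \<zeta> $ j)))"
    unfolding Duits_Kuijlaars_block_def Let_def matrix_CD_kernel_eq[OF n R] single
      double_integral_eq[OF n biv] ..
  show ?thesis
    unfolding mat2_kernel_K block scalar(2) eigval_def Q_eq_mat2 dyad_eq_mat2
      \<phi>_def[symmetric] \<phi>_eq[symmetric]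
    using scalar(1) by blast
qed

end
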